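(* Let $f\in\mathrm{AC}^1$, let $x\in[-1,1]$ and let $n_j$ be a sequence such that \[ \lim_{j\to\infty} n_j\,\big(B_{n_j}(f,x)-f(x)\big)=L\in\overline{\mathbb{R}}.\qquad(\ast) \] (i) Suppose $n_j$ is odd. If $x$ is irrational then $L\in\mathcal{O}(f,x):=\big[-\tfrac{2|O(f,x)|}{\pi},\tfrac{2|O(f,x)|}{\pi}\big]$. If $x$ is rational then the set $\mathcal{O}(x)$ defined below is a finite subset of $\mathbb{R}\setminus\{0\}$, and if $x$ is regular for $n_j$ then $L\in\mathcal{O}(f,x):=\{O(f,x)/y:\ y\in\mathcal{O}(x)\}$. Conversely (for $x$ irrational, or rational in $(-1,1)$), if $L\in\mathcal{O}(f,x)$ then there exists an odd sequence $n_j$ for which $x$ is regular and $(\ast)$ holds. (ii) Suppose $n_j$ is even. If $x$ is irrational then $L\in\mathcal{E}(f,x):=\big[-\tfrac{2|E(f,x)|}{\pi},\tfrac{2|E(f,x)|}{\pi}\big]$. If $x$ is rational then the set $\mathcal{E}(x)$ defined below is a finite subset of $\mathbb{R}\setminus\{0\}$, and if $x$ is regular for $n_j$ then $L\in\mathcal{E}(f,x):=\{E(f,x)/y:\ y\in\mathcal{E}(x)\}$. Conversely, if $L\in\mathcal{E}(f,x)$ then there exists an even sequence $n_j$ for which $x$ is regular and $(\ast)$ holds.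
   Context: Nodes: $x_{k,n}:=2k/n-1$, $k=0,\dots,n$. Berrut's interpolant: $B_n(f,x):=N_n(f,x)/D_n(x)$ for $x$ not a node, $B_n(f,x_{k,n}):=f(x_{k,n})$, with $N_n(f,x)=\sum_{k=0}^n(-1)^k\frac{f(x_{k,n})}{x-x_{k,n}}$, $D_n(x)=\sum_{k=0}^n(-1)^k\frac{1}{x-x_{k,n}}$. $\mathrm{AC}^1$ is the class of $f:[-1,1]\to\mathbb{R}$ that are differentiable at every point of $[-1,1]$ (one-sided derivatives at $\pm1$) with $f'$ absolutely continuous on $[-1,1]$. A "sequence $n_j$" is a strictly increasing function $\mathbb{N}\to\mathbb{N}$, $j\mapsto n_j$; it is odd (even) if every $n_j$ is odd (even). A point $x\in[-1,1]$ is regular for $n_j$ if there is $j_0$ such that for $j\ge j_0$, $x\notin\{x_{0,n_j},\dots,x_{n_j,n_j}\}$. $\overline{\mathbb{R}}=\mathbb{R}\cup\{+\infty,-\infty\}$ is the two-point compactification with its usual topology. For $x\in(-1,1)$, \[ O(f,x):=\frac{f(x)-f(1)}{2(x-1)}-\frac{f(x)-f(-1)}{2(x+1)},\qquad E(f,x):=\frac{f(1)-f(x)}{2(x-1)}+\frac{f(-1)-f(x)}{2(x+1)}. \] For rational $x\in(-1,1)$, $\mathcal{O}(x)$ is the set of all $y\in\overline{\mathbb{R}}$ such that $\lim_{j\to\infty}D_{n_j}(x)/n_j=y$ for some odd sequence $n_j$ for which $x$ is regular; $\mathcal{E}(x)$ is defined in the same way with even sequences. *)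

theory Defs
  imports "HOL-Analysis.Analysis"
begin

definition node :: "nat \<Rightarrow> nat \<Rightarrow> real" where
  "node k n = 2 * real k / real n - 1"

definition Nb :: "nat \<Rightarrow> (real \<Rightarrow> real) \<Rightarrow> real \<Rightarrow> real" where
  "Nb n f x = (\<Sum>k\<le>n. (-1) ^ k * f (node k n) / (x - node k n))"

definition Db :: "nat \<Rightarrow> real \<Rightarrow> real" where
  "Db n x = (\<Sum>k\<le>n. (-1) ^ k / (x - node k n))"

definition berrut :: "nat \<Rightarrow> (real \<Rightarrow> real) \<Rightarrow> real \<Rightarrow> real" where
  "berrut n f x = (if \<exists>k\<le>n. x = node k n then f x else Nb n f x / Db n x)"

definition abs_continuous_on :: "real \<Rightarrow> real \<Rightarrow> (real \<Rightarrow> real) \<Rightarrow> bool" where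
  "abs_continuous_on a b g \<longleftrightarrow>
     (\<forall>\<epsilon>>0. \<exists>\<delta>>0. \<forall>(m::nat) (u::nat \<Rightarrow> real) (v::nat \<Rightarrow> real).
        (\<forall>i<m. a \<le> u i \<and> u i \<le> v i \<and> v i \<le> b) \<and>
        (\<forall>i<m. \<forall>k<m. i \<noteq> k \<longrightarrow> v i \<le> u k \<or> v k \<le> u i) \<and>
        (\<Sum>i<m. v i - u i) < \<delta>
        \<longrightarrow> (\<Sum>i<m. \<bar>g (v i) - g (u i)\<bar>) < \<epsilon>)"

definition AC1 :: "(real \<Rightarrow> real) \<Rightarrow> bool" where
  "AC1 f \<longleftrightarrow> (\<exists>f'. (\<forall>t\<in>{-1..1}. (f has_real_derivative f' t) (at t within {-1..1}))
                  \<and> abs_continuous_on (-1) 1 f')"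

definition regular :: "real \<Rightarrow> (nat \<Rightarrow> nat) \<Rightarrow> bool" where
  "regular x nj \<longleftrightarrow> (\<exists>j0. \<forall>j\<ge>j0. \<forall>k\<le>nj j. x \<noteq> node k (nj j))"

definition Ofun :: "(real \<Rightarrow> real) \<Rightarrow> real \<Rightarrow> real" where
  "Ofun f x = (f x - f 1) / (2 * (x - 1)) - (f x - f (-1)) / (2 * (x + 1))"

definition Efun :: "(real \<Rightarrow> real) \<Rightarrow> real \<Rightarrow> real" where
  "Efun f x = (f 1 - f x) / (2 * (x - 1)) + (f (-1) - f x) / (2 * (x + 1))"

definition Oset :: "real \<Rightarrow> ereal set" where
  "Oset x = {y. \<exists>nj. strict_mono nj \<and> (\<forall>j. odd (nj j)) \<and> regular x nj \<and>
                 ((\<lambda>j. ereal (Db (nj j) x / real (nj j))) \<longlongrightarrow> y) sequentially}"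

definition Eset :: "real \<Rightarrow> ereal set" where
  "Eset x = {y. \<exists>nj. strict_mono nj \<and> (\<forall>j. even (nj j)) \<and> regular x nj \<and>
                 ((\<lambda>j. ereal (Db (nj j) x / real (nj j))) \<longlongrightarrow> y) sequentially}"

definition star_lim :: "(real \<Rightarrow> real) \<Rightarrow> real \<Rightarrow> (nat \<Rightarrow> nat) \<Rightarrow> ereal \<Rightarrow> bool" where
  "star_lim f x nj L \<longleftrightarrow>
     ((\<lambda>j. ereal (real (nj j) * (berrut (nj j) f x - f x))) \<longlongrightarrow> L) sequentially"

definition OfSet :: "(real \<Rightarrow> real) \<Rightarrow> real \<Rightarrow> ereal set" where
  "OfSet f x = (if x \<in> \<rat> then {ereal (Ofun f x / y) | y. ereal y \<in> Oset x}
                else ereal ` {- 2 * \<bar>Ofun f x\<bar> / pi .. 2 * \<bar>Ofun f x\<bar> / pi})"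

definition EfSet :: "(real \<Rightarrow> real) \<Rightarrow> real \<Rightarrow> ereal set" where
  "EfSet f x = (if x \<in> \<rat> then {ereal (Efun f x / y) | y. ereal y \<in> Eset x}
                else ereal ` {- 2 * \<bar>Efun f x\<bar> / pi .. 2 * \<bar>Efun f x\<bar> / pi})"

end

theory Submission
  imports Defs
begin

text \<open>Put \<open>g(t) = (f(t) - f(x)) / (t - x)\<close>. Then \<open>n (B\<^sub>n(f,x) - f(x))\<close> is the quotient of
  \<open>-\<Sum>\<^sub>k (-1)\<^sup>k g(x\<^sub>k)\<close> by \<open>D\<^sub>n(x)/n\<close>. The function \<open>g\<close> is absolutely continuous, and
  continuously differentiable away from \<open>x\<close>, so its alternating sum over the nodes is asymptotic to
  half the alternating sum of its end values; this gives \<open>O(f,x)\<close> for odd and \<open>E(f,x)\<close> for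
  even \<open>n\<close>. By the partial fraction expansion of the cosecant, \<open>D\<^sub>n(x)/n\<close> differs from
  \<open>\<pi> / (2 sin (\<pi> n (x + 1) / 2))\<close> by \<open>O(1/n)\<close>. For irrational \<open>x\<close> these sines are dense in
  \<open>[-1, 1]\<close> along each parity class by Kronecker's theorem; for rational \<open>x\<close> they take finitely
  many values, and they vanish only when \<open>x\<close> is a node.\<close>

section \<open>Partial fractions of the cosecant\<close>

text \<open>Logarithmic derivative of the reflection formula:
  \<open>Gamma t * Gamma (1 - t) * sin (pi * t)\<close> is constant on (0, 1), so its derivative at
  \<open>x\<close>, also computed by the product rule, vanishes.\<close>

lemma Digamma_reflection_real:
  fixes x :: real
  assumes x: "0 < x" "x < 1"
  shows "Digamma (1 - x) - Digamma x = pi * cos (pi * x) / sin (pi * x)"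
proof -
  have nonint: "t \<notin> \<int>\<^sub>\<le>\<^sub>0" if "0 < t" for t :: real
    using that nonpos_Ints_nonpos by fastforce
  have spos: "sin (pi * t) > 0" if "0 < t" "t < 1" for t
    using that by (intro sin_gt_zero) auto
  have const: "Gamma t * Gamma (1 - t) * sin (pi * t) = pi" if t: "0 < t" "t < 1" for t :: real
  proof -
    have "complex_of_real (Gamma t * Gamma (1 - t)) = complex_of_real (pi / sin (pi * t))"
      using Gamma_reflection_complex[of "complex_of_real t"] Gamma_complex_of_real[of t]
        Gamma_complex_of_real[of "1 - t"] sin_of_real[of "pi * t", where 'a = complex] by simp
    then have "Gamma t * Gamma (1 - t) = pi / sin (pi * t)"
      using of_real_eq_iff by blast
    then show ?thesis using spos[OF t] by simp
  qed
  let ?G = "Gamma x * Gamma (1 - x)"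
  have "((\<lambda>t. Gamma t * Gamma (1 - t) * sin (pi * t)) has_real_derivative
      ?G * (Digamma x - Digamma (1 - x)) * sin (pi * x) + ?G * (pi * cos (pi * x))) (at x)"
  proof -
    have 1: "(Gamma has_real_derivative Gamma x * Digamma x) (at x)"
      using x by (intro has_field_derivative_Gamma nonint) auto
    have 2: "((\<lambda>t. Gamma (1 - t)) has_real_derivative Gamma (1 - x) * Digamma (1 - x) * (- 1)) (at x)"
      using x by (intro DERIV_chain2[OF has_field_derivative_Gamma] nonint)
        (auto intro!: derivative_eq_intros)
    have 3: "((\<lambda>t. sin (pi * t)) has_real_derivative cos (pi * x) * pi) (at x)"
      by (auto intro!: derivative_eq_intros)
    show ?thesis
      using DERIV_mult[OF DERIV_mult[OF 1 2] 3] by (rule DERIV_cong) (simp add: algebra_simps)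
  qed
  moreover have "((\<lambda>t. Gamma t * Gamma (1 - t) * sin (pi * t)) has_real_derivative 0) (at x)"
  proof -
    have "eventually (\<lambda>t. t \<in> {0<..<1}) (nhds x)"
      using x by (intro eventually_nhds_in_open) auto
    then have "eventually (\<lambda>t. Gamma t * Gamma (1 - t) * sin (pi * t) = pi) (nhds x)"
      by eventually_elim (auto simp: const)
    then show ?thesis by (subst DERIV_cong_ev[OF refl _ refl]) auto
  qed
  ultimately have "?G * (Digamma x - Digamma (1 - x)) * sin (pi * x) + ?G * (pi * cos (pi * x)) = 0"
    by (rule DERIV_unique)
  then have "?G * ((Digamma x - Digamma (1 - x)) * sin (pi * x) + pi * cos (pi * x)) = 0"
    by (simp only: distrib_left mult.assoc)
  moreover have "?G \<noteq> 0" using x by (simp add: Gamma_real_pos less_imp_neq[symmetric])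
  ultimately have "(Digamma x - Digamma (1 - x)) * sin (pi * x) + pi * cos (pi * x) = 0" by simp
  then show ?thesis using spos[OF x] by (simp add: field_simps)
qed

text \<open>\<open>Digamma\<close> is the limit of a logarithm minus a harmonic-type sum; in
  \<open>Digamma (1 - x) - Digamma x\<close> the logarithms cancel, and the reflection formula
  supplies the value.\<close>

lemma cot_partial_fractions:
  fixes x :: real
  assumes x: "0 < x" "x < 1"
  shows "(\<lambda>m. \<Sum>n<m. 1 / (x + real n) - 1 / (1 - x + real n)) \<longlonglongrightarrow> pi * cos (pi * x) / sin (pi * x)"
proof -
  have "(\<lambda>m. (ln (real m) - (\<Sum>n<m. inverse (1 - x + real n))) - (ln (real m) - (\<Sum>n<m. inverse (x + real n))))
      \<longlonglongrightarrow> Digamma (1 - x) - Digamma x"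
    using Digamma_LIMSEQ[of "1 - x"] Digamma_LIMSEQ[of x] x by (intro tendsto_diff) auto
  then show ?thesis
    using x by (simp add: Digamma_reflection_real sum_subtractf inverse_eq_divide algebra_simps)
qed

text \<open>Each term is a sign times a factor that is positive and decreasing for positive
  \<open>a\<close>, the form that the Leibniz criterion expects.\<close>

definition alt_harm :: "real \<Rightarrow> nat \<Rightarrow> real" where
  "alt_harm a m = (\<Sum>i<m. (-1) ^ i * (1 / (a + real i)))"

definition alt_harm_inf :: "real \<Rightarrow> real" where
  "alt_harm_inf a = (\<Sum>i. (-1) ^ i * (1 / (a + real i)))"

text \<open>Leibniz criterion: even partial sums lie below the limit and odd ones above it, so the
  error is at most the first omitted term.\<close>

lemma alt_harm_tail:
  assumes a: "0 < a"
  shows "\<bar>alt_harm a m - alt_harm_inf a\<bar> \<le> 1 / (a + real m)"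
    and "(\<lambda>m. alt_harm a (2 * m)) \<longlonglongrightarrow> alt_harm_inf a"
proof -
  have l: "(\<lambda>i. 1 / (a + real i)) \<longlonglongrightarrow> 0"
    by (intro tendsto_divide_0[OF tendsto_const] filterlim_at_top_imp_at_infinity
        filterlim_tendsto_add_at_top[OF tendsto_const] filterlim_real_sequentially)
  note L = summable_Leibniz'[OF l]
  have pos: "0 \<le> 1 / (a + real i)" and mono: "1 / (a + real (Suc i)) \<le> 1 / (a + real i)" for i
    using a by (auto intro!: divide_left_mono mult_pos_pos)
  show "(\<lambda>m. alt_harm a (2 * m)) \<longlonglongrightarrow> alt_harm_inf a"
    unfolding alt_harm_def alt_harm_inf_def by (rule L(3)[OF pos mono])
  have lo: "alt_harm a (2 * n) \<le> alt_harm_inf a" for n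
    unfolding alt_harm_def alt_harm_inf_def by (rule L(2)[OF pos mono])
  have hi: "alt_harm_inf a \<le> alt_harm a (2 * n + 1)" for n
    unfolding alt_harm_def alt_harm_inf_def by (rule L(4)[OF pos mono])
  have suc: "alt_harm a (Suc n) = alt_harm a n + (-1) ^ n * (1 / (a + real n))" for n
    by (simp add: alt_harm_def)
  show "\<bar>alt_harm a m - alt_harm_inf a\<bar> \<le> 1 / (a + real m)"
  proof (cases "even m")
    case True
    then obtain n where "m = 2 * n" by blast
    then show ?thesis using lo[of n] hi[of n] suc[of m] by simp
  next
    case False
    then obtain n where "m = 2 * n + 1" using oddE by blast
    then show ?thesis using lo[of "Suc n"] hi[of n] suc[of m] by simp
  qed
qed

text \<open>The half-angle identity cot(y/2) - cot(y) = 1/sin(y) at y = pi x turns two cotangent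
  expansions into one of the cosecant.\<close>

lemma cosec_partial_fractions:
  fixes x :: real
  assumes x: "0 < x" "x < 1"
  shows "alt_harm_inf x + alt_harm_inf (1 - x) = pi / sin (pi * x)"
proof -
  let ?c = "\<lambda>y m. \<Sum>n<m. 1 / (y + real n) - 1 / (1 - y + real n)"
  have sp: "sin (pi * x / 2) > 0" "cos (pi * x / 2) > 0" 
    using x by (auto intro!: sin_gt_zero cos_gt_zero)
  \<comment> \<open>With x/2 in place of x, the terms become 2/(x + 2n) and 2/(1 - x + (2n + 1)).
    Subtracting the series at \<open>x\<close>, taken to twice the length, leaves alternating signs
    in both of its parts.\<close>
  have eq: "?c (x / 2) m - ?c x (2 * m) = alt_harm x (2 * m) + alt_harm (1 - x) (2 * m)" for m
  proof (induction m)
    case 0 then show ?case by (simp add: alt_harm_def)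
  next
    case (Suc m)
    have "1 / (x / 2 + real m) = 2 / (x + 2 * real m)"
      "1 / (1 - x / 2 + real m) = 2 / (1 - x + (2 * real m + 1))"
      using x by (auto simp: field_simps)
    then have "?c (x / 2) (Suc m) =
        ?c (x / 2) m + (2 / (x + 2 * real m) - 2 / (1 - x + (2 * real m + 1)))"
      by simp
    moreover have "?c x (2 * Suc m) = ?c x (2 * m) + (1 / (x + 2 * real m) - 1 / (1 - x + 2 * real m))
        + (1 / (x + (2 * real m + 1)) - 1 / (1 - x + (2 * real m + 1)))"
      by (simp add: add.commute[of 1])
    moreover have "alt_harm a (2 * Suc m) = alt_harm a (2 * m) + 1 / (a + 2 * real m) - 1 / (a + (2 * real m + 1))" for a
      by (simp add: alt_harm_def add.commute[of 1])
    ultimately show ?case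
      using Suc by (simp only: diff_divide_distrib)
  qed
  have "(\<lambda>m. ?c (x / 2) m - ?c x (2 * m)) \<longlonglongrightarrow>
      pi * cos (pi * (x / 2)) / sin (pi * (x / 2)) - pi * cos (pi * x) / sin (pi * x)"
    using x LIMSEQ_subseq_LIMSEQ[OF cot_partial_fractions[OF x], of "(*) 2"]
    by (intro tendsto_diff cot_partial_fractions) (auto simp: strict_mono_def o_def)
  moreover have "(\<lambda>m. alt_harm x (2 * m) + alt_harm (1 - x) (2 * m)) \<longlonglongrightarrow> alt_harm_inf x + alt_harm_inf (1 - x)"
    using x by (intro tendsto_add alt_harm_tail) auto
  ultimately have "alt_harm_inf x + alt_harm_inf (1 - x) =
      pi * cos (pi * (x / 2)) / sin (pi * (x / 2)) - pi * cos (pi * x) / sin (pi * x)"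
    unfolding eq by (rule LIMSEQ_unique[rotated])
  also have "\<dots> = pi / sin (pi * x)"
  proof -
    have d: "sin (pi * x) = 2 * sin (pi * x / 2) * cos (pi * x / 2)" "cos (pi * x) = 2 * (cos (pi * x / 2))\<^sup>2 - 1"
      using sin_double[of "pi * x / 2"] cos_double_cos[of "pi * x / 2"] by simp_all
    show ?thesis unfolding d using sp by (simp add: field_simps power2_eq_square)
  qed
  finally show ?thesis .
qed

text \<open>Splitting at the integer part \<open>N\<close> of \<open>z\<close> and reading both
  pieces outwards from \<open>z\<close> gives truncations of the two alternating series for the
  cosecant, at \<theta> and 1 - \<theta>, with common sign \<open>(-1) ^ N\<close>. The bound
  collects the two Leibniz errors.\<close>

lemma alternating_sum_cosec:
  fixes z :: real
  assumes z: "0 < z" "z < real n" "z \<notin> \<int>"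
  shows "\<bar>(\<Sum>k\<le>n. (-1) ^ k / (z - real k)) - pi / sin (pi * z)\<bar> \<le> 1 / z + 1 / (real n - z)"
proof -
  define N where "N = nat \<lfloor>z\<rfloor>"
  define \<theta> where "\<theta> = z - real N"
  have \<theta>: "0 < \<theta>" "\<theta> < 1"
  proof -
    have rN: "real N = of_int \<lfloor>z\<rfloor>" using z unfolding N_def by simp
    show "\<theta> < 1" unfolding \<theta>_def rN by linarith
    have "z \<noteq> of_int \<lfloor>z\<rfloor>" using z(3) by (metis Ints_of_int)
    then show "0 < \<theta>" unfolding \<theta>_def rN using of_int_floor_le[of z] by linarith
  qed
  have zN: "z = real N + \<theta>" by (simp add: \<theta>_def)
  have Nn: "N < n" using z \<theta> zN by linarith
  have "(\<Sum>k\<le>n. (-1) ^ k / (z - real k)) = 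
      (\<Sum>k<Suc N. (-1) ^ k / (z - real k)) + (\<Sum>k=Suc N..<Suc n. (-1) ^ k / (z - real k))"
    unfolding lessThan_Suc_atMost[symmetric] lessThan_atLeast0
    by (rule sum.atLeastLessThan_concat[symmetric]) (use Nn in auto)
  also have "(\<Sum>k<Suc N. (-1) ^ k / (z - real k)) = (-1) ^ N * alt_harm \<theta> (Suc N)"
  proof -
    have "(\<Sum>k<Suc N. (-1) ^ k / (z - real k)) = (\<Sum>i<Suc N. (-1) ^ (Suc N - Suc i) / (z - real (Suc N - Suc i)))"
      by (rule sum.nat_diff_reindex[symmetric])
    also have "\<dots> = (\<Sum>i<Suc N. (-1) ^ N * ((-1) ^ i * (1 / (\<theta> + real i))))"
    proof (rule sum.cong[OF refl])
      fix i assume "i \<in> {..<Suc N}"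
      then have i: "i \<le> N" by simp
      then have "(-1::real) ^ (N - i) = (-1) ^ N * (-1) ^ i"
        by (auto simp: minus_one_power_iff)
      then show "(-1) ^ (Suc N - Suc i) / (z - real (Suc N - Suc i)) = (-1) ^ N * ((-1) ^ i * (1 / (\<theta> + real i)))"
        using i by (simp add: zN of_nat_diff algebra_simps)
    qed
    finally show ?thesis by (simp only: alt_harm_def sum_distrib_left)
  qed
  also have "(\<Sum>k=Suc N..<Suc n. (-1) ^ k / (z - real k)) = (-1) ^ N * alt_harm (1 - \<theta>) (n - N)"
  proof -
    have "(\<Sum>k=Suc N..<Suc n. (-1) ^ k / (z - real k)) = (\<Sum>i<n - N. (-1) ^ (i + Suc N) / (z - real (i + Suc N)))"
      using sum.shift_bounds_nat_ivl[of "\<lambda>k. (-1) ^ k / (z - real k)" 0 "Suc N" "n - N"] Nn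
      by (simp add: lessThan_atLeast0)
    also have "\<dots> = (\<Sum>i<n - N. (-1) ^ N * ((-1) ^ i * (1 / (1 - \<theta> + real i))))"
    proof (rule sum.cong[OF refl])
      fix i
      define D where "D = 1 - \<theta> + real i"
      \<comment> \<open>To the right of \<open>z\<close> the denominators are negative, which
        absorbs the extra sign from starting at \<open>Suc N\<close>.\<close>
      have "z - real (i + Suc N) = - D" by (simp add: zN D_def)
      then show "(-1) ^ (i + Suc N) / (z - real (i + Suc N)) = (-1) ^ N * ((-1) ^ i * (1 / (1 - \<theta> + real i)))"
        unfolding D_def[symmetric] by (simp add: power_add)
    qed
    finally show ?thesis by (simp only: alt_harm_def sum_distrib_left)
  qed
  finally have 1: "(\<Sum>k\<le>n. (-1) ^ k / (z - real k)) = (-1) ^ N * (alt_harm \<theta> (Suc N) + alt_harm (1 - \<theta>) (n - N))"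
    by (simp add: algebra_simps)
  have "pi / sin (pi * z) = (-1) ^ N * (pi / sin (pi * \<theta>))"
  proof -
    have "sin (pi * z) = (-1) ^ N * sin (pi * \<theta>)"
      by (simp add: zN distrib_left sin_add mult.commute[of pi])
    then show ?thesis by (simp add: minus_one_power_iff)
  qed
  also have "pi / sin (pi * \<theta>) = alt_harm_inf \<theta> + alt_harm_inf (1 - \<theta>)"
    using cosec_partial_fractions[OF \<theta>] by simp
  finally have "(\<Sum>k\<le>n. (-1) ^ k / (z - real k)) - pi / sin (pi * z) =
     (-1) ^ N * ((alt_harm \<theta> (Suc N) - alt_harm_inf \<theta>) + (alt_harm (1 - \<theta>) (n - N) - alt_harm_inf (1 - \<theta>)))"
    by (simp add: 1 algebra_simps)
  then have "\<bar>(\<Sum>k\<le>n. (-1) ^ k / (z - real k)) - pi / sin (pi * z)\<bar> \<le> 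
      \<bar>alt_harm \<theta> (Suc N) - alt_harm_inf \<theta>\<bar> + \<bar>alt_harm (1 - \<theta>) (n - N) - alt_harm_inf (1 - \<theta>)\<bar>"
    by (simp add: abs_mult)
  also have "\<dots> \<le> 1 / (\<theta> + real (Suc N)) + 1 / (1 - \<theta> + real (n - N))"
    using \<theta> by (intro add_mono alt_harm_tail) auto
  also have "\<dots> \<le> 1 / z + 1 / (real n - z)"
    using z Nn by (intro add_mono divide_left_mono mult_pos_pos) (auto simp: zN of_nat_diff)
  finally show ?thesis .
qed

section \<open>Position of x among the nodes and the size of D_n(x)/n\<close>

definition nphase :: "real \<Rightarrow> nat \<Rightarrow> real" where
  "nphase x n = sin (pi * (real n * (x + 1) / 2))"

text \<open>The number \<open>real n * (x + 1) / 2\<close> is the fractional index of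
  \<open>x\<close> in the node grid; for \<open>x\<close> inside the interval it lies between 0 and
  \<open>n\<close>, so an integer value would be the index of a node.\<close>

lemma off_nodes_not_Ints:
  assumes x: "-1 < x" "x < 1" and nz: "n \<noteq> 0" and nn: "\<forall>k\<le>n. x \<noteq> node k n"
  shows "real n * (x + 1) / 2 \<notin> \<int>"
proof
  assume "real n * (x + 1) / 2 \<in> \<int>"
  then obtain i :: int where i: "real n * (x + 1) / 2 = of_int i" by (rule Ints_cases)
  have "real n * (x + 1) / 2 > 0" using x nz by simp
  moreover have "real n * (x + 1) / 2 \<le> real n * 2 / 2"
    using x by (intro divide_right_mono mult_left_mono) auto
  ultimately have "0 \<le> i" "i \<le> int n" unfolding i by linarith+
  then have "nat i \<le> n" "real (nat i) = real n * (x + 1) / 2" using i by auto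
  then have "x = node (nat i) n" using nz by (simp add: node_def field_simps)
  then show False using nn \<open>nat i \<le> n\<close> by blast
qed

lemma nphase_nonzero:
  assumes x: "-1 < x" "x < 1" and nz: "n \<noteq> 0" and nn: "\<forall>k\<le>n. x \<noteq> node k n"
  shows "nphase x n \<noteq> 0"
  using off_nodes_not_Ints[OF assms]
  unfolding nphase_def sin_zero_iff_int2 by (auto simp: mult.commute[of pi])

text \<open>In terms of the fractional index z = n(x + 1)/2 of \<open>x\<close>, the differences
  \<open>x - node k n\<close> are (2/n)(z - k), which reduces the claim to
  \<open>alternating_sum_cosec\<close>.\<close>

lemma Db_asymp:
  assumes x: "-1 < x" "x < 1" and nz: "n \<noteq> 0" and nn: "\<forall>k\<le>n. x \<noteq> node k n"
  shows "\<bar>Db n x / real n - pi / (2 * nphase x n)\<bar> \<le> (1 / (1 + x) + 1 / (1 - x)) / real n"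
proof -
  let ?z = "real n * (x + 1) / 2"
  have D: "Db n x / real n = (\<Sum>k\<le>n. (-1) ^ k / (?z - real k)) / 2"
    unfolding Db_def sum_divide_distrib
  proof (rule sum.cong[OF refl])
    fix k
    have "x - node k n = 2 * (?z - real k) / real n" using nz by (simp add: node_def field_simps)
    then show "(-1) ^ k / (x - node k n) / real n = (-1) ^ k / (?z - real k) / 2"
      using nz by simp
  qed
  have "\<bar>(\<Sum>k\<le>n. (-1) ^ k / (?z - real k)) - pi / sin (pi * ?z)\<bar> \<le> 1 / ?z + 1 / (real n - ?z)"
  proof (rule alternating_sum_cosec)
    show "?z < real n" using x nz by (simp add: field_simps)
  qed (use x nz off_nodes_not_Ints[OF assms] in auto)
  moreover have "Db n x / real n - pi / (2 * nphase x n) =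
      ((\<Sum>k\<le>n. (-1) ^ k / (?z - real k)) - pi / sin (pi * ?z)) / 2"
    unfolding D nphase_def by (simp add: diff_divide_distrib)
  ultimately have "\<bar>Db n x / real n - pi / (2 * nphase x n)\<bar> \<le> (1 / ?z + 1 / (real n - ?z)) / 2"
    by (simp only: abs_divide) simp
  also have "\<dots> = (1 / (1 + x) + 1 / (1 - x)) / real n"
  proof -
    have "real n - ?z = real n * (1 - x) / 2" by (simp add: field_simps)
    moreover have "1 / ?z / 2 = 1 / (1 + x) / real n" using x nz by (simp add: add.commute mult.commute)
    moreover have "1 / (real n * (1 - x) / 2) / 2 = 1 / (1 - x) / real n" using x nz by (simp add: mult.commute)
    ultimately show ?thesis by (simp only: add_divide_distrib)
  qed
  finally show ?thesis .
qed

section \<open>Alternating sums over the nodes\<close>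

text \<open>The definition indexes families by initial segments of the naturals. Enumerating
  \<open>I\<close> transfers it to arbitrary finite index sets, such as sets of node indices with
  gaps.\<close>

lemma abs_continuous_on_finite:
  assumes "abs_continuous_on a b g" "\<epsilon> > 0"
  shows "\<exists>\<delta>>0. \<forall>(I :: 'i set) u v. finite I \<and> (\<forall>i\<in>I. a \<le> u i \<and> u i \<le> v i \<and> v i \<le> b) \<and>
       (\<forall>i\<in>I. \<forall>k\<in>I. i \<noteq> k \<longrightarrow> v i \<le> u k \<or> v k \<le> u i) \<and> (\<Sum>i\<in>I. v i - u i) < \<delta>
       \<longrightarrow> (\<Sum>i\<in>I. \<bar>g (v i) - g (u i)\<bar>) < \<epsilon>"
proof -
  obtain \<delta> where \<delta>: "\<delta> > 0" and ac: "\<forall>(m::nat) (u::nat \<Rightarrow> real) (v::nat \<Rightarrow> real).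
        (\<forall>i<m. a \<le> u i \<and> u i \<le> v i \<and> v i \<le> b) \<and>
        (\<forall>i<m. \<forall>k<m. i \<noteq> k \<longrightarrow> v i \<le> u k \<or> v k \<le> u i) \<and>
        (\<Sum>i<m. v i - u i) < \<delta>
        \<longrightarrow> (\<Sum>i<m. \<bar>g (v i) - g (u i)\<bar>) < \<epsilon>"
    using assms unfolding abs_continuous_on_def by blast
  have "(\<Sum>i\<in>I. \<bar>g (v i) - g (u i)\<bar>) < \<epsilon>"
    if fin: "finite I" and rng: "\<forall>i\<in>I. a \<le> u i \<and> u i \<le> v i \<and> v i \<le> b"
      and disj: "\<forall>i\<in>I. \<forall>k\<in>I. i \<noteq> k \<longrightarrow> v i \<le> u k \<or> v k \<le> u i"
      and len: "(\<Sum>i\<in>I. v i - u i) < \<delta>" for I :: "'i set" and u v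
  proof -
    obtain h where h: "bij_betw h {..<card I} I"
      using ex_bij_betw_nat_finite[OF fin] by (auto simp: lessThan_atLeast0)
    have hI: "h i \<in> I" if "i < card I" for i using h that by (auto simp: bij_betw_def)
    have hne: "h i \<noteq> h k" if "i < card I" "k < card I" "i \<noteq> k" for i k
      using h that by (auto simp: bij_betw_def inj_on_def)
    have "(\<Sum>i<card I. \<bar>g ((v \<circ> h) i) - g ((u \<circ> h) i)\<bar>) < \<epsilon>"
    proof (rule ac[rule_format], intro conjI allI impI)
      show "(\<Sum>i<card I. (v \<circ> h) i - (u \<circ> h) i) < \<delta>"
        using len sum.reindex_bij_betw[OF h, of "\<lambda>i. v i - u i"] by simp
    qed (use rng disj hI hne in auto)
    then show ?thesis using sum.reindex_bij_betw[OF h, of "\<lambda>i. \<bar>g (v i) - g (u i)\<bar>"] by simp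
  qed
  with \<delta> show ?thesis by blast
qed

lemma abs_continuous_on_imp_continuous_on:
  assumes "abs_continuous_on a b g"
  shows "continuous_on {a..b} g"
  unfolding continuous_on_iff
proof (intro ballI allI impI)
  fix s and e :: real assume s: "s \<in> {a..b}" and "e > 0"
  \<comment> \<open>Continuity needs only one interval at a time, hence the one-element index type
    \<open>unit\<close>.\<close>
  obtain \<delta> where \<delta>: "\<delta> > 0" and ac:
    "\<forall>(I :: unit set) u v. finite I \<and> (\<forall>i\<in>I. a \<le> u i \<and> u i \<le> v i \<and> v i \<le> b) \<and>
       (\<forall>i\<in>I. \<forall>k\<in>I. i \<noteq> k \<longrightarrow> v i \<le> u k \<or> v k \<le> u i) \<and> (\<Sum>i\<in>I. v i - u i) < \<delta>
       \<longrightarrow> (\<Sum>i\<in>I. \<bar>g (v i) - g (u i)\<bar>) < e"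
    using abs_continuous_on_finite[OF assms \<open>e > 0\<close>, where 'i = unit] by blast
  have *: "\<bar>g v - g u\<bar> < e" if "a \<le> u" "u \<le> v" "v \<le> b" "v - u < \<delta>" for u v
    using ac[rule_format, of UNIV "\<lambda>_. u" "\<lambda>_. v"] that by simp
  have "dist (g t) (g s) < e" if t: "t \<in> {a..b}" "dist t s < \<delta>" for t
    using *[of s t] *[of t s] s t by (cases "s \<le> t") (auto simp: dist_real_def abs_minus_commute)
  with \<delta> show "\<exists>d>0. \<forall>t\<in>{a..b}. dist t s < d \<longrightarrow> dist (g t) (g s) < e" by blast
qed

section \<open>Absolute continuity of the difference quotient\<close>

definition slope :: "(real \<Rightarrow> real) \<Rightarrow> (real \<Rightarrow> real) \<Rightarrow> real \<Rightarrow> real \<Rightarrow> real" where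
  "slope f f' x t = (if t = x then f' x else (f t - f x) / (t - x))"

text \<open>Fundamental theorem of calculus along the segment from \<open>x\<close> to
  \<open>t\<close>, divided by \<open>t - x\<close>. The value \<open>f' x\<close> given to the
  slope at \<open>t = x\<close> makes the formula hold there too, with a constant integrand.\<close>

lemma slope_has_integral:
  assumes der: "\<And>t. t \<in> {a..b} \<Longrightarrow> (f has_real_derivative f' t) (at t within {a..b})"
    and x: "x \<in> {a..b}" and t: "t \<in> {a..b}"
  shows "((\<lambda>s. f' (x + s * (t - x))) has_integral slope f f' x t) {0..1}"
proof (cases "t = x")
  case True
  then show ?thesis using has_integral_const_real[of "f' x" 0 1] by (simp add: slope_def)
next
  case False
  have mem: "x + s * (t - x) \<in> {a..b}" if "s \<in> {0..1}" for s
  proof -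
    have "x + s * (t - x) = (1 - s) * x + s * t" by (simp add: algebra_simps)
    then show ?thesis
      using convexD_alt[OF convex_real_interval(5)[of a b] x t, of s] that by simp
  qed
  have "((\<lambda>s. f' (x + s * (t - x)) * (t - x)) has_integral f (x + 1 * (t - x)) - f (x + 0 * (t - x))) {0..1}"
  proof (rule fundamental_theorem_of_calculus)
    fix s :: real assume s: "s \<in> {0..1}"
    have "((\<lambda>s. f (x + s * (t - x))) has_real_derivative f' (x + s * (t - x)) * (t - x)) (at s within {0..1})"
    proof (rule DERIV_image_chain[where g = "\<lambda>s. x + s * (t - x)", unfolded o_def])
      show "(f has_real_derivative f' (x + s * (t - x))) (at (x + s * (t - x)) within (\<lambda>s. x + s * (t - x)) ` {0..1})"
        by (rule has_field_derivative_subset[OF der]) (use mem s in auto)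
    qed (auto intro!: derivative_eq_intros)
    then show "((\<lambda>s. f (x + s * (t - x))) has_vector_derivative f' (x + s * (t - x)) * (t - x)) (at s within {0..1})"
      by (simp add: has_real_derivative_iff_has_vector_derivative)
  qed simp
  from has_integral_mult_left[OF this, of "1 / (t - x)"] show ?thesis
    using False by (simp add: slope_def)
qed

text \<open>By \<open>slope_has_integral\<close> the slope is an average of rescaled copies of \<open>f'\<close>, and rescaling
  towards \<open>x\<close> does not increase the total length of a family of intervals.\<close>
lemma abs_continuous_on_slope:
  assumes der: "\<And>t. t \<in> {a..b} \<Longrightarrow> (f has_real_derivative f' t) (at t within {a..b})"
    and ac: "abs_continuous_on a b f'" and x: "x \<in> {a..b}"
  shows "abs_continuous_on a b (slope f f' x)"
  unfolding abs_continuous_on_def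
proof (intro allI impI)
  fix \<epsilon> :: real assume "\<epsilon> > 0"
  \<comment> \<open>Integrating a strict pointwise bound is only used to give a weak one; halving
    \<epsilon> restores strictness at the end.\<close>
  then have "\<epsilon> / 2 > 0" by simp
  then obtain \<delta> where \<delta>: "\<delta> > 0" and small: "\<forall>(m::nat) (u::nat \<Rightarrow> real) (v::nat \<Rightarrow> real).
        (\<forall>i<m. a \<le> u i \<and> u i \<le> v i \<and> v i \<le> b) \<and>
        (\<forall>i<m. \<forall>k<m. i \<noteq> k \<longrightarrow> v i \<le> u k \<or> v k \<le> u i) \<and>
        (\<Sum>i<m. v i - u i) < \<delta>
        \<longrightarrow> (\<Sum>i<m. \<bar>f' (v i) - f' (u i)\<bar>) < \<epsilon> / 2"
    using ac unfolding abs_continuous_on_def by blast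
  have "(\<Sum>i<m. \<bar>slope f f' x (v i) - slope f f' x (u i)\<bar>) < \<epsilon>"
    if rng: "\<forall>i<m. a \<le> u i \<and> u i \<le> v i \<and> v i \<le> b"
      and disj: "\<forall>i<m. \<forall>k<m. i \<noteq> k \<longrightarrow> v i \<le> u k \<or> v k \<le> u i"
      and len: "(\<Sum>i<m. v i - u i) < \<delta>" for m :: nat and u v
  proof -
    define p where "p s t = x + s * (t - x)" for s t
    have p_mem: "a \<le> p s t \<and> p s t \<le> b" if "s \<in> {0..1}" "t \<in> {a..b}" for s t
    proof -
      have "p s t = (1 - s) * x + s * t" by (simp add: algebra_simps p_def)
      then show ?thesis
        using convexD_alt[OF convex_real_interval(5)[of a b] x, of t s] that by simp
    qed
    have p_mono: "p s t \<le> p s t'" if "s \<in> {0..1}" "t \<le> t'" for s t t'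
      using that by (auto simp: p_def intro!: mult_left_mono)
    define F where "F i s = f' (p s (v i)) - f' (p s (u i))" for i s
    \<comment> \<open>These signs do not depend on \<open>s\<close>, so the sum of absolute values
      becomes the integral of one finite linear combination of the \<open>F i\<close>.\<close>
    define \<sigma> where "\<sigma> i = sgn (slope f f' x (v i) - slope f f' x (u i))" for i
    have int: "(F i has_integral (slope f f' x (v i) - slope f f' x (u i))) {0..1}" if "i < m" for i
    proof -
      have "u i \<in> {a..b}" "v i \<in> {a..b}" using rng that by force+
      then show ?thesis unfolding F_def p_def
        by (intro has_integral_diff slope_has_integral[OF der x])
    qed
    have "((\<lambda>s. \<Sum>i<m. \<sigma> i * F i s) has_integral
        (\<Sum>i<m. \<sigma> i * (slope f f' x (v i) - slope f f' x (u i)))) {0..1}"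
      by (intro has_integral_sum has_integral_mult_right int) auto
    also have "(\<Sum>i<m. \<sigma> i * (slope f f' x (v i) - slope f f' x (u i))) =
        (\<Sum>i<m. \<bar>slope f f' x (v i) - slope f f' x (u i)\<bar>)"
      by (simp add: \<sigma>_def abs_sgn mult.commute)
    finally have I: "((\<lambda>s. \<Sum>i<m. \<sigma> i * F i s) has_integral
        (\<Sum>i<m. \<bar>slope f f' x (v i) - slope f f' x (u i)\<bar>)) {0..1}" .
    \<comment> \<open>For fixed \<open>s\<close> the contraction \<open>p s\<close> keeps the
      intervals inside, in order and non-overlapping, and multiplies their total length by
      \<open>s\<close>, which is at most 1; so the estimate for \<open>f'\<close> applies.\<close>
    have "(\<Sum>i<m. \<sigma> i * F i s) \<le> \<epsilon> / 2" if s: "s \<in> {0..1}" for s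
    proof -
      have "(\<Sum>i<m. \<sigma> i * F i s) \<le> (\<Sum>i<m. \<bar>F i s\<bar>)"
        by (intro sum_mono) (auto simp: \<sigma>_def sgn_if)
      also have "\<dots> < \<epsilon> / 2"
        unfolding F_def
      proof (rule small[rule_format], intro conjI allI impI)
        fix i assume i: "i < m"
        then have "u i \<in> {a..b}" "v i \<in> {a..b}" "u i \<le> v i" using rng by force+
        then show "a \<le> p s (u i)" "p s (u i) \<le> p s (v i)" "p s (v i) \<le> b"
          using p_mem[OF s] p_mono[OF s] by auto
        fix k assume "k < m" "i \<noteq> k"
        with i show "p s (v i) \<le> p s (u k) \<or> p s (v k) \<le> p s (u i)"
          using disj p_mono[OF s] by blast
      next
        have "(\<Sum>i<m. p s (v i) - p s (u i)) = s * (\<Sum>i<m. v i - u i)"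
          by (simp add: p_def sum_distrib_left algebra_simps)
        also have "\<dots> \<le> 1 * (\<Sum>i<m. v i - u i)"
          using s rng by (intro mult_right_mono sum_nonneg) auto
        finally show "(\<Sum>i<m. p s (v i) - p s (u i)) < \<delta>" using len by simp
      qed
      finally show ?thesis by simp
    qed
    then have "(\<Sum>i<m. \<bar>slope f f' x (v i) - slope f f' x (u i)\<bar>) \<le> \<epsilon> / 2"
      using has_integral_le[OF I has_integral_const_real[of "\<epsilon> / 2" 0 1]] by simp
    then show ?thesis using \<open>\<epsilon> > 0\<close> by simp
  qed
  with \<delta> show "\<exists>\<delta>>0. \<forall>(m::nat) u v.
        (\<forall>i<m. a \<le> u i \<and> u i \<le> v i \<and> v i \<le> b) \<and>
        (\<forall>i<m. \<forall>k<m. i \<noteq> k \<longrightarrow> v i \<le> u k \<or> v k \<le> u i) \<and>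
        (\<Sum>i<m. v i - u i) < \<delta>
        \<longrightarrow> (\<Sum>i<m. \<bar>slope f f' x (v i) - slope f f' x (u i)\<bar>) < \<epsilon>"
    by blast
qed

section \<open>Alternating sums and second differences\<close>

lemma alternating_sum_by_parts:
  fixes a :: "nat \<Rightarrow> real"
  shows "(\<Sum>k\<le>n. (-1) ^ k * a k) = (a 0 + (-1) ^ n * a n) / 2 + (\<Sum>k<n. (-1) ^ k * (a k - a (Suc k))) / 2"
proof (induction n)
  case (Suc n)
  have "(\<Sum>k\<le>Suc n. (-1) ^ k * a k) = (\<Sum>k\<le>n. (-1) ^ k * a k) - (-1) ^ n * a (Suc n)" by simp
  moreover have "(\<Sum>k<Suc n. (-1) ^ k * (a k - a (Suc k))) =
      (\<Sum>k<n. (-1) ^ k * (a k - a (Suc k))) + ((-1) ^ n * a n - (-1) ^ n * a (Suc n))"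
    by (simp add: right_diff_distrib)
  moreover have "(-1) ^ Suc n * a (Suc n) = - ((-1) ^ n * a (Suc n))" by simp
  \<comment> \<open>The linear algebra of the induction step in plain variables: \<open>p\<close>
    and \<open>q\<close> stand for \<open>(-1) ^ n\<close> times \<open>a n\<close> and
    \<open>a (Suc n)\<close>, and \<open>w\<close> for the new signed end term.\<close>
  moreover have "S' = (c + w) / 2 + T' / 2"
    if "S' = S - q" "T' = T + (p - q)" "w = - q" "S = (c + p) / 2 + T / 2" for S S' T T' p q w c :: real
    using that by (simp add: field_simps)
  ultimately show ?case using Suc.IH by blast
qed simp

text \<open>Summation by parts pairs half of each term with half of its neighbour, trading terms for
  differences. Doing it twice leaves second differences and the two end differences; the factors 1/4
  are dropped.\<close>

lemma alternating_sum_second_differences: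
  fixes a :: "nat \<Rightarrow> real"
  assumes "n \<ge> 1"
  shows "\<bar>(\<Sum>k\<le>n. (-1) ^ k * a k) - (a 0 + (-1) ^ n * a n) / 2\<bar> \<le>
    \<bar>a 1 - a 0\<bar> + \<bar>a n - a (n - 1)\<bar> + (\<Sum>k<n - 1. \<bar>a (k + 2) - 2 * a (k + 1) + a k\<bar>)"
proof -
  obtain N where N: "n = Suc N" using assms by (cases n) auto
  define d where "d k = a k - a (Suc k)" for k
  let ?T = "\<Sum>k<N. (-1) ^ k * (d k - d (Suc k))"
  have "(\<Sum>k<n. (-1) ^ k * d k) = (d 0 + (-1) ^ N * d N) / 2 + ?T / 2"
    unfolding N lessThan_Suc_atMost by (rule alternating_sum_by_parts)
  then have eq: "(\<Sum>k\<le>n. (-1) ^ k * a k) - (a 0 + (-1) ^ n * a n) / 2 = (d 0 + (-1) ^ N * d N) / 4 + ?T / 4"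
    unfolding alternating_sum_by_parts[of a n] d_def[symmetric] by (simp add: field_simps)
  have "\<bar>?T\<bar> \<le> (\<Sum>k<N. \<bar>(-1) ^ k * (d k - d (Suc k))\<bar>)" by (rule sum_abs)
  also have "\<dots> = (\<Sum>k<n - 1. \<bar>a (k + 2) - 2 * a (k + 1) + a k\<bar>)"
    by (auto simp: N d_def abs_mult power_abs intro!: sum.cong)
  finally have T: "\<bar>?T\<bar> \<le> (\<Sum>k<n - 1. \<bar>a (k + 2) - 2 * a (k + 1) + a k\<bar>)" .
  have "\<bar>(-1) ^ N * d N\<bar> = \<bar>d N\<bar>" by (simp add: abs_mult power_abs)
  moreover have "\<bar>d 0\<bar> = \<bar>a 1 - a 0\<bar>" "\<bar>d N\<bar> = \<bar>a n - a (n - 1)\<bar>"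
    by (auto simp: d_def N)
  moreover have "\<bar>(p + q) / 4 + t / 4\<bar> \<le> \<bar>p\<bar> + \<bar>q\<bar> + \<bar>t\<bar>" for p q t :: real by (simp add: field_simps)
  note this[of "d 0" "(-1) ^ N * d N" ?T]
  ultimately show ?thesis unfolding eq using T by simp
qed

lemma card_nat_near:
  fixes c r :: real
  assumes "finite K" "\<And>k. k \<in> K \<Longrightarrow> \<bar>real k - c\<bar> < r" "0 \<le> r"
  shows "real (card K) \<le> 2 * r + 1"
proof -
  have "int ` K \<subseteq> {\<lceil>c - r\<rceil>..\<lfloor>c + r\<rfloor>}"
  proof clarsimp
    fix k assume "k \<in> K"
    then have "\<bar>real k - c\<bar> < r" by (rule assms)
    then show "\<lceil>c - r\<rceil> \<le> int k \<and> int k \<le> \<lfloor>c + r\<rfloor>" by (simp add: ceiling_le_iff le_floor_iff abs_less_iff)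
  qed
  then have "card (int ` K) \<le> card {\<lceil>c - r\<rceil>..\<lfloor>c + r\<rfloor>}" by (intro card_mono) auto
  then have "real (card K) \<le> real (nat (\<lfloor>c + r\<rfloor> - \<lceil>c - r\<rceil> + 1))" by (simp add: card_image)
  also have "\<dots> \<le> 2 * r + 1"
  \<comment> \<open>If no integer lies in the range, \<open>nat\<close> may truncate a negative
    number to 0, and the bound is trivial.\<close>
  proof (cases "\<lfloor>c + r\<rfloor> - \<lceil>c - r\<rceil> + 1 \<ge> 0")
    case True
    then have "real (nat (\<lfloor>c + r\<rfloor> - \<lceil>c - r\<rceil> + 1)) = of_int \<lfloor>c + r\<rfloor> - of_int \<lceil>c - r\<rceil> + 1" by simp
    then show ?thesis using of_int_floor_le[of "c + r"] le_of_int_ceiling[of "c - r"] by linarith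
  qed (use assms in simp)
  finally show ?thesis .
qed

lemma node_simps: "n \<noteq> 0 \<Longrightarrow> node 0 n = -1" "n \<noteq> 0 \<Longrightarrow> node n n = 1"
  by (auto simp: node_def)

lemma node_le_iff: "n \<noteq> 0 \<Longrightarrow> node i n \<le> node k n \<longleftrightarrow> i \<le> k"
  by (simp add: node_def divide_le_cancel)

lemma node_mem: "n \<noteq> 0 \<Longrightarrow> k \<le> n \<Longrightarrow> node k n \<in> {-1..1}"
  using node_le_iff[of n 0 k] node_le_iff[of n k n] by (simp add: node_simps)

lemma node_diff: "node (k + i) n - node k n = 2 * real i / real n"
  by (simp add: node_def add_divide_distrib distrib_left)

text \<open>Away from \<open>x\<close> the second differences are \<open>o(1/n)\<close> each; near \<open>x\<close> their sum is controlled
  by the variation of \<open>h\<close> over a short interval.\<close>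
lemma alternating_node_sum_limit:
  fixes h h' :: "real \<Rightarrow> real"
  assumes ac: "abs_continuous_on (-1) 1 h"
    and der: "\<And>t. t \<in> {-1..1} \<Longrightarrow> t \<noteq> x \<Longrightarrow> (h has_real_derivative h' t) (at t within {-1..1})"
    and cont: "continuous_on ({-1..1} - {x}) h'"
  shows "(\<lambda>n. (\<Sum>k\<le>n. (-1) ^ k * h (node k n)) - (h (-1) + (-1) ^ n * h 1) / 2) \<longlonglongrightarrow> 0"
proof (rule LIMSEQ_I)
  fix e :: real assume "e > 0"
  \<comment> \<open>The total will be below 6 \<epsilon>: one for each end difference, two for the
    indices near \<open>x\<close>, two for the others.\<close>
  define \<epsilon> where "\<epsilon> = e / 8"
  have \<epsilon>: "\<epsilon> > 0" using \<open>e > 0\<close> by (simp add: \<epsilon>_def)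
  obtain \<delta> where \<delta>: "\<delta> > 0" and var:
    "\<forall>(I :: nat set) u v. finite I \<and> (\<forall>i\<in>I. -1 \<le> u i \<and> u i \<le> v i \<and> v i \<le> 1) \<and>
       (\<forall>i\<in>I. \<forall>k\<in>I. i \<noteq> k \<longrightarrow> v i \<le> u k \<or> v k \<le> u i) \<and> (\<Sum>i\<in>I. v i - u i) < \<delta>
       \<longrightarrow> (\<Sum>i\<in>I. \<bar>h (v i) - h (u i)\<bar>) < \<epsilon>"
    using abs_continuous_on_finite[OF ac \<epsilon>, where 'i = nat] by blast
  \<comment> \<open>Near \<open>x\<close> there will be at most 2 \<eta> n + 1 intervals of length
    2/n, of total length at most 4 \<eta> + 2/n, which is below \<delta> once 4/n < \<eta>.\<close>
  define \<eta> where "\<eta> = \<delta> / 8"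
  have \<eta>: "\<eta> > 0" using \<delta> by (simp add: \<eta>_def)
  define A where "A = {-1..1} - ball x \<eta>"
  have "compact A" unfolding A_def by (intro compact_diff) auto
  moreover have "continuous_on A h'" using \<eta> by (intro continuous_on_subset[OF cont]) (auto simp: A_def)
  ultimately have "uniformly_continuous_on A h'" by (intro compact_uniformly_continuous)
  then obtain \<rho> where \<rho>: "\<rho> > 0" and unif: "\<And>s t. s \<in> A \<Longrightarrow> t \<in> A \<Longrightarrow> dist t s < \<rho> \<Longrightarrow> dist (h' t) (h' s) < \<epsilon>"
    using \<epsilon> unfolding uniformly_continuous_on_def by metis
  \<comment> \<open>A second difference spans two steps, of length 4/n in all; this must be smaller
    than both \<rho> and \<eta>.\<close>
  obtain N0 :: nat where N0: "real N0 > 4 / \<rho> + 4 / \<eta>" using reals_Archimedean2 by blast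
  have "norm ((\<Sum>k\<le>n. (-1) ^ k * h (node k n)) - (h (-1) + (-1) ^ n * h 1) / 2 - 0) < e"
    if n: "n \<ge> N0" for n
  proof -
    have nb: "real n > 4 / \<rho> + 4 / \<eta>" using N0 n by linarith
    then have npos: "real n > 0" using \<rho> \<eta> by (smt (verit) divide_pos_pos)
    then have n0: "n \<noteq> 0" by simp
    have "real n > 4 / \<rho>" "real n > 4 / \<eta>" using nb \<rho> \<eta> by (smt (verit) divide_pos_pos)+
    then have n\<rho>: "4 / real n < \<rho>" and n\<eta>: "4 / real n < \<eta>"
      using npos \<rho> \<eta> by (simp_all add: field_simps)
    define a where "a k = h (node k n)" for k
    have step: "node (Suc k) n = node k n + 2 / real n" for k
      using node_diff[of k 1 n] by simp
    have le: "node i n \<le> node k n" if "i \<le> k" for i k using node_le_iff[OF n0] that by simp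
    have mem: "-1 \<le> node k n \<and> node k n \<le> 1" if "k \<le> n" for k using node_mem[OF n0 that] by simp
    have family: "(\<Sum>k\<in>I. \<bar>a (Suc k) - a k\<bar>) < \<epsilon>"
      if I: "finite I" "\<And>k. k \<in> I \<Longrightarrow> Suc k \<le> n" "real (card I) * (2 / real n) < \<delta>" for I
      unfolding a_def
    proof (rule var[rule_format], intro conjI ballI impI)
      fix i k assume "i \<in> I" "k \<in> I" "i \<noteq> k"
      then have "Suc i \<le> k \<or> Suc k \<le> i" by auto
      then show "node (Suc i) n \<le> node k n \<or> node (Suc k) n \<le> node i n" using le by blast
    next
      fix i assume "i \<in> I"
      then show "-1 \<le> node i n" "node i n \<le> node (Suc i) n" "node (Suc i) n \<le> 1"
        using mem[of i] mem[of "Suc i"] I(2)[of i] le[of i "Suc i"] by simp_all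
    next
      show "finite I" by (rule I(1))
    next
      show "(\<Sum>i\<in>I. node (Suc i) n - node i n) < \<delta>" using I(3) by (simp add: step)
    qed
    have "2 / real n < \<delta>" using n\<eta> npos \<delta> unfolding \<eta>_def by (simp add: field_simps)
    then have single: "\<bar>a (Suc k) - a k\<bar> < \<epsilon>" if "Suc k \<le> n" for k
      using family[of "{k}"] that by simp
    \<comment> \<open>The radius is 2 \<eta> rather than \<eta>, so that for \<open>k\<close>
      outside \<open>K\<close> all of the span from node \<open>k\<close> to node
      \<open>k + 2\<close> keeps distance at least \<eta> from \<open>x\<close> and lies in
      \<open>A\<close>.\<close>
    define K where "K = {k. k < n - 1 \<and> \<bar>node k n - x\<bar> < 2 * \<eta>}"
    have finK: "finite K" by (rule finite_subset[of _ "{..<n}"]) (auto simp: K_def)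
    have cardK: "real (card K) \<le> 2 * (\<eta> * real n) + 1"
    proof (rule card_nat_near[OF finK, where c = "real n * (x + 1) / 2"])
      fix k assume "k \<in> K"
      then have "\<bar>node k n - x\<bar> < 2 * \<eta>" by (simp add: K_def)
      moreover have "real k - real n * (x + 1) / 2 = (node k n - x) * (real n / 2)"
        using npos by (simp add: node_def field_simps)
      ultimately show "\<bar>real k - real n * (x + 1) / 2\<bar> < \<eta> * real n"
        using npos by (simp only: abs_mult) simp
    qed (use \<eta> in simp)
    have lenK: "real (card K) * (2 / real n) < \<delta>"
    proof -
      have "real (card K) * (2 / real n) \<le> (2 * (\<eta> * real n) + 1) * (2 / real n)"
        using cardK npos by (intro mult_right_mono) auto
      also have "\<dots> = 4 * \<eta> + 2 / real n" using npos by (simp add: field_simps)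
      also have "\<dots> < \<delta>" using n\<eta> npos \<delta> unfolding \<eta>_def by (simp add: field_simps)
      finally show ?thesis .
    qed
    \<comment> \<open>Each second difference is at most two consecutive first differences; these are
      indexed by \<open>K\<close> and \<open>Suc\<close> followed by image of \<open>K\<close>, and
      \<open>family\<close> bounds each of the two sums.\<close>
    have near: "(\<Sum>k\<in>K. \<bar>a (k + 2) - 2 * a (k + 1) + a k\<bar>) \<le> 2 * \<epsilon>"
    proof -
      have "(\<Sum>k\<in>K. \<bar>a (k + 2) - 2 * a (k + 1) + a k\<bar>) \<le>
          (\<Sum>k\<in>K. \<bar>a (Suc (Suc k)) - a (Suc k)\<bar> + \<bar>a (Suc k) - a k\<bar>)"
        by (intro sum_mono) simp
      also have "\<dots> = (\<Sum>k\<in>Suc ` K. \<bar>a (Suc k) - a k\<bar>) + (\<Sum>k\<in>K. \<bar>a (Suc k) - a k\<bar>)"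
        by (simp add: sum.distrib sum.reindex)
      also have "\<dots> \<le> \<epsilon> + \<epsilon>"
      proof (intro add_mono)
        have "(\<Sum>k\<in>Suc ` K. \<bar>a (Suc k) - a k\<bar>) < \<epsilon>"
          using finK lenK by (intro family) (auto simp: K_def card_image)
        then show "(\<Sum>k\<in>Suc ` K. \<bar>a (Suc k) - a k\<bar>) \<le> \<epsilon>" by simp
        have "(\<Sum>k\<in>K. \<bar>a (Suc k) - a k\<bar>) < \<epsilon>"
          using finK lenK by (intro family) (auto simp: K_def)
        then show "(\<Sum>k\<in>K. \<bar>a (Suc k) - a k\<bar>) \<le> \<epsilon>" by simp
      qed
      finally show ?thesis by simp
    qed
    have mv: "\<exists>\<xi>\<in>{node k n..node (Suc k) n}. a (Suc k) - a k = h' \<xi> * (2 / real n)"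
      if k: "Suc k \<le> n" "{node k n..node (Suc k) n} \<subseteq> A" for k
    proof -
      have "\<exists>\<xi>\<in>{node k n..node (Suc k) n}. h (node (Suc k) n) - h (node k n) = h' \<xi> * (node (Suc k) n - node k n)"
      proof (rule mvt_very_simple[OF le])
        fix t assume t: "node k n \<le> t" "t \<le> node (Suc k) n"
        then have "t \<in> A" using k by auto
        then have "(h has_real_derivative h' t) (at t within {-1..1})"
          using \<eta> by (intro der) (auto simp: A_def)
        then have "(h has_real_derivative h' t) (at t within {node k n..node (Suc k) n})"
          by (rule has_field_derivative_subset) (use k in \<open>auto simp: A_def\<close>)
        then show "(h has_derivative (\<lambda>d. h' t * d)) (at t within {node k n..node (Suc k) n})"
          by (simp add: has_field_derivative_def)
      qed simp
      then show ?thesis by (simp add: a_def step)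
    qed
    \<comment> \<open>The mean value theorem on two adjacent steps gives points less than \<rho>
      apart, where \<open>h'\<close> differs by less than \<epsilon>.\<close>
    have far1: "\<bar>a (k + 2) - 2 * a (k + 1) + a k\<bar> \<le> \<epsilon> * (2 / real n)" if k: "k \<in> {..<n - 1} - K" for k
    proof -
      have kn: "Suc (Suc k) \<le> n" and kx: "\<bar>node k n - x\<bar> \<ge> 2 * \<eta>" using k by (auto simp: K_def)
      have sub: "t \<in> A" if "node k n \<le> t" "t \<le> node (Suc (Suc k)) n" for t
        using that n\<eta> kx mem[of k] mem[of "Suc (Suc k)"] kn
        by (auto simp: A_def dist_real_def step)
      have "{node k n..node (Suc k) n} \<subseteq> A" "{node (Suc k) n..node (Suc (Suc k)) n} \<subseteq> A"
        using sub le[of k "Suc k"] le[of "Suc k" "Suc (Suc k)"] by force+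
      then obtain \<xi>1 \<xi>2 where
        1: "\<xi>1 \<in> {node k n..node (Suc k) n}" "a (Suc k) - a k = h' \<xi>1 * (2 / real n)" "\<xi>1 \<in> A" and
        2: "\<xi>2 \<in> {node (Suc k) n..node (Suc (Suc k)) n}" "a (Suc (Suc k)) - a (Suc k) = h' \<xi>2 * (2 / real n)" "\<xi>2 \<in> A"
        using mv[of k] mv[of "Suc k"] kn by (meson Suc_leD subsetD)
      have "dist \<xi>2 \<xi>1 < \<rho>" using 1(1) 2(1) n\<rho> by (auto simp: dist_real_def step)
      then have "\<bar>h' \<xi>2 - h' \<xi>1\<bar> < \<epsilon>" using unif[OF 1(3) 2(3)] by (simp add: dist_real_def)
      moreover have "a (k + 2) - 2 * a (k + 1) + a k = (h' \<xi>2 - h' \<xi>1) * (2 / real n)"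
        unfolding left_diff_distrib 1(2)[symmetric] 2(2)[symmetric] by simp
      ultimately show ?thesis using npos by (simp only: abs_mult) (intro mult_mono, auto)
    qed
    have far: "(\<Sum>k\<in>{..<n - 1} - K. \<bar>a (k + 2) - 2 * a (k + 1) + a k\<bar>) \<le> 2 * \<epsilon>"
    proof -
      have "(\<Sum>k\<in>{..<n - 1} - K. \<bar>a (k + 2) - 2 * a (k + 1) + a k\<bar>) \<le> (\<Sum>k\<in>{..<n - 1} - K. \<epsilon> * (2 / real n))"
        by (intro sum_mono far1)
      also have "\<dots> \<le> (\<Sum>k\<in>{..<n}. \<epsilon> * (2 / real n))" using \<epsilon> by (intro sum_mono2) auto
      also have "\<dots> = 2 * \<epsilon>" using npos by simp
      finally show ?thesis .
    qed
    have "(\<Sum>k<n - 1. \<bar>a (k + 2) - 2 * a (k + 1) + a k\<bar>) =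
       (\<Sum>k\<in>{..<n - 1} - K. \<bar>a (k + 2) - 2 * a (k + 1) + a k\<bar>) + (\<Sum>k\<in>K. \<bar>a (k + 2) - 2 * a (k + 1) + a k\<bar>)"
      by (intro sum.subset_diff) (auto simp: K_def)
    then have "(\<Sum>k<n - 1. \<bar>a (k + 2) - 2 * a (k + 1) + a k\<bar>) \<le> 4 * \<epsilon>" using near far by simp
    moreover have "\<bar>a 1 - a 0\<bar> < \<epsilon>" "\<bar>a n - a (n - 1)\<bar> < \<epsilon>"
      using single[of 0] single[of "n - 1"] n0 by auto
    moreover have "\<bar>(\<Sum>k\<le>n. (-1) ^ k * a k) - (a 0 + (-1) ^ n * a n) / 2\<bar> \<le>
      \<bar>a 1 - a 0\<bar> + \<bar>a n - a (n - 1)\<bar> + (\<Sum>k<n - 1. \<bar>a (k + 2) - 2 * a (k + 1) + a k\<bar>)"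
      using n0 by (intro alternating_sum_second_differences) simp
    ultimately have "\<bar>(\<Sum>k\<le>n. (-1) ^ k * a k) - (a 0 + (-1) ^ n * a n) / 2\<bar> < e"
      using \<open>e > 0\<close> unfolding \<epsilon>_def by linarith
    then show ?thesis by (simp add: a_def node_simps[OF n0])
  qed
  then show "\<exists>no. \<forall>n\<ge>no. norm ((\<Sum>k\<le>n. (-1) ^ k * h (node k n)) - (h (-1) + (-1) ^ n * h 1) / 2 - 0) < e"
    by blast
qed

text \<open>Here \<open>g\<close> is the slope function of \<open>f\<close> at \<open>x\<close>:
  absolutely continuous throughout, and continuously differentiable away from \<open>x\<close>. Its
  value at \<open>x\<close> stays hidden, since later it is evaluated only at nodes different from
  \<open>x\<close>.\<close>

lemma berrut_numerator_limit:
  assumes "AC1 f" and x: "-1 < x" "x < 1"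
  obtains g where "\<And>t. t \<noteq> x \<Longrightarrow> g t = (f t - f x) / (t - x)"
    and "(\<lambda>n. (\<Sum>k\<le>n. (-1) ^ k * g (node k n)) - (g (-1) + (-1) ^ n * g 1) / 2) \<longlonglongrightarrow> 0"
proof -
  obtain f' where der: "\<And>t. t \<in> {-1..1} \<Longrightarrow> (f has_real_derivative f' t) (at t within {-1..1})"
    and ac: "abs_continuous_on (-1) 1 f'"
    using \<open>AC1 f\<close> unfolding AC1_def by blast
  \<comment> \<open>The quotient rule for the difference quotient, valid away from
    \<open>x\<close>.\<close>
  define h' where "h' t = (f' t * (t - x) - (f t - f x)) / ((t - x) * (t - x))" for t
  have "(\<lambda>n. (\<Sum>k\<le>n. (-1) ^ k * slope f f' x (node k n)) - (slope f f' x (-1) + (-1) ^ n * slope f f' x 1) / 2) \<longlonglongrightarrow> 0"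
  proof (rule alternating_node_sum_limit)
    show "abs_continuous_on (-1) 1 (slope f f' x)"
      using x by (intro abs_continuous_on_slope der ac) auto
    have "continuous_on {-1..1} f" using der by (rule DERIV_continuous_on)
    then show "continuous_on ({-1..1} - {x}) h'"
      unfolding h'_def using abs_continuous_on_imp_continuous_on[OF ac]
      by (intro continuous_intros) (auto elim: continuous_on_subset)
    fix t assume t: "t \<in> {-1..1}" "t \<noteq> x"
    have "((\<lambda>t. (f t - f x) / (t - x)) has_real_derivative h' t) (at t within {-1..1})"
      unfolding h'_def using t der[OF t(1)] by (auto intro!: derivative_eq_intros)
    then show "(slope f f' x has_real_derivative h' t) (at t within {-1..1})"
    proof (rule has_field_derivative_transform_within[where d = "\<bar>t - x\<bar>"])
      fix s assume "dist s t < \<bar>t - x\<bar>"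
      then have "s \<noteq> x" by (auto simp: dist_real_def)
      then show "(f s - f x) / (s - x) = slope f f' x s" by (simp add: slope_def)
    qed (use t in auto)
  qed
  then show thesis using that[of "slope f f' x"] by (simp add: slope_def)
qed

section \<open>The scaled interpolation error\<close>

text \<open>The flag \<open>b\<close> stands for evenness, so that the odd and even cases share one
  proof.\<close>

definition parity_fun :: "bool \<Rightarrow> (real \<Rightarrow> real) \<Rightarrow> real \<Rightarrow> real" where
  "parity_fun b f x = (if b then Efun f x else Ofun f x)"

definition parity_set :: "bool \<Rightarrow> real \<Rightarrow> ereal set" where
  "parity_set b x = {y. \<exists>nj. strict_mono nj \<and> (\<forall>j. even (nj j) = b) \<and> regular x nj \<and>
                 ((\<lambda>j. ereal (Db (nj j) x / real (nj j))) \<longlongrightarrow> y) sequentially}"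

definition parity_fset :: "bool \<Rightarrow> (real \<Rightarrow> real) \<Rightarrow> real \<Rightarrow> ereal set" where
  "parity_fset b f x = (if x \<in> \<rat> then {ereal (parity_fun b f x / y) | y. ereal y \<in> parity_set b x}
     else ereal ` {- 2 * \<bar>parity_fun b f x\<bar> / pi .. 2 * \<bar>parity_fun b f x\<bar> / pi})"

text \<open>The error is the quotient of \<open>Nb n f x - f x * Db n x\<close> by
  \<open>Db n x\<close>, and subtracting the constant \<open>f x\<close> termwise turns this
  numerator into difference quotients at the nodes.\<close>

lemma berrut_error_quotient:
  assumes nn: "\<forall>k\<le>n. x \<noteq> node k n" and D: "Db n x \<noteq> 0" and n: "n \<noteq> 0"
    and g: "\<And>t. t \<noteq> x \<Longrightarrow> g t = (f t - f x) / (t - x)"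
  shows "real n * (berrut n f x - f x) = - (\<Sum>k\<le>n. (-1) ^ k * g (node k n)) / (Db n x / real n)"
proof -
  have "Nb n f x - f x * Db n x = - (\<Sum>k\<le>n. (-1) ^ k * g (node k n))"
    unfolding Nb_def Db_def sum_distrib_left sum_subtractf[symmetric] sum_negf[symmetric]
  proof (rule sum.cong[OF refl])
    fix k assume "k \<in> {..n}"
    then have ne: "x \<noteq> node k n" using nn by simp
    then have "g (node k n) = (f (node k n) - f x) / (node k n - x)" using g[of "node k n"] by simp
    also have "\<dots> = - ((f (node k n) - f x) / (x - node k n))"
      by (metis minus_diff_eq divide_minus_right)
    finally show "(-1) ^ k * f (node k n) / (x - node k n) - f x * ((-1) ^ k / (x - node k n)) = - ((-1) ^ k * g (node k n))"
      by (simp add: diff_divide_distrib right_diff_distrib mult.commute)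
  qed
  moreover have "berrut n f x - f x = (Nb n f x - f x * Db n x) / Db n x"
    using nn D by (auto simp: berrut_def field_simps)
  ultimately show ?thesis using n by simp
qed

lemma abs_nphase_le_1: "\<bar>nphase x n\<bar> \<le> 1"
  by (simp add: nphase_def)

lemma strict_mono_eventually_ge: "strict_mono (nj :: nat \<Rightarrow> nat) \<Longrightarrow> eventually (\<lambda>j. nj j \<ge> N) sequentially"
  using filterlim_subseq[of nj] by (auto simp: filterlim_at_top)

lemma regular_eventually:
  assumes "strict_mono nj" "regular x nj"
  shows "eventually (\<lambda>j. nj j \<noteq> 0 \<and> (\<forall>k\<le>nj j. x \<noteq> node k (nj j))) sequentially"
proof -
  have "eventually (\<lambda>j. \<forall>k\<le>nj j. x \<noteq> node k (nj j)) sequentially"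
    using assms(2) unfolding regular_def eventually_sequentially .
  with strict_mono_eventually_ge[OF assms(1), of 1] show ?thesis by eventually_elim auto
qed

text \<open>Both endpoints are nodes for every positive \<open>n\<close>.\<close>

lemma regular_interior:
  assumes "x \<in> {-1..1}" "strict_mono nj" "regular x nj"
  shows "-1 < x" "x < 1"
proof -
  obtain j where j: "nj j \<noteq> 0" "\<forall>k\<le>nj j. x \<noteq> node k (nj j)"
    using eventually_happens[OF regular_eventually[OF assms(2,3)]] by auto
  then have "x \<noteq> -1" "x \<noteq> 1" using node_simps[of "nj j"] by (metis le0, metis order_refl)
  then show "-1 < x" "x < 1" using assms(1) by auto
qed

lemma Db_nphase_limit:
  assumes x: "-1 < x" "x < 1" and nj: "strict_mono nj" "regular x nj"
  shows "(\<lambda>j. Db (nj j) x / real (nj j) - pi / (2 * nphase x (nj j))) \<longlonglongrightarrow> 0"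
proof (rule Lim_null_comparison)
  let ?C = "1 / (1 + x) + 1 / (1 - x)"
  show "eventually (\<lambda>j. norm (Db (nj j) x / real (nj j) - pi / (2 * nphase x (nj j))) \<le> ?C / real (nj j)) sequentially"
    using regular_eventually[OF nj] by eventually_elim (use Db_asymp[OF x] in auto)
  have "(\<lambda>n. ?C / real n) \<longlonglongrightarrow> 0" by (rule lim_const_over_n)
  from LIMSEQ_subseq_LIMSEQ[OF this nj(1)] show "(\<lambda>j. ?C / real (nj j)) \<longlonglongrightarrow> 0"
    by (simp add: o_def)
qed

text \<open>Both \<open>D\<^sub>n(x)/n\<close> and its approximation \<open>\<pi>/(2 sin(\<dots>))\<close> have modulus at least \<open>1\<close> eventually,
  so their reciprocals are as close as they are.\<close>
lemma berrut_error_nphase_limit: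
  assumes f: "AC1 f" and x: "-1 < x" "x < 1" and nj: "strict_mono nj" "regular x nj"
    and par: "\<forall>j. even (nj j) = b"
  shows "(\<lambda>j. real (nj j) * (berrut (nj j) f x - f x) - parity_fun b f x * (2 * nphase x (nj j) / pi)) \<longlonglongrightarrow> 0"
proof -
  obtain g where g: "\<And>t. t \<noteq> x \<Longrightarrow> g t = (f t - f x) / (t - x)"
    and gl: "(\<lambda>n. (\<Sum>k\<le>n. (-1) ^ k * g (node k n)) - (g (-1) + (-1) ^ n * g 1) / 2) \<longlonglongrightarrow> 0"
    using berrut_numerator_limit[OF f x] by blast
  define p where "p = parity_fun b f x"
  define T where "T j = - (\<Sum>k\<le>nj j. (-1) ^ k * g (node k (nj j)))" for j
  define d where "d j = Db (nj j) x / real (nj j)" for j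
  define \<nu> where "\<nu> j = nphase x (nj j)" for j
  \<comment> \<open>The parity fixes the sign \<open>(-1) ^ nj j\<close>; the half sum of end values
    is then \<open>Ofun\<close> or \<open>Efun\<close> up to sign.\<close>
  have "(g (-1) + (-1) ^ nj j * g 1) / 2 = - p" for j
  proof -
    have g1: "g 1 = - ((f 1 - f x) / (x - 1))" "g (-1) = - ((f (-1) - f x) / (x + 1))"
      using x g[of 1] g[of "-1"] by (auto simp: field_simps)
    have "(-1::real) ^ nj j = (if b then 1 else -1)" using par by (simp add: minus_one_power_iff)
    then show ?thesis unfolding p_def parity_fun_def Ofun_def Efun_def g1
      by (simp add: add_divide_distrib diff_divide_distrib mult.commute)
  qed
  then have T0: "(\<lambda>j. T j - p) \<longlonglongrightarrow> 0"
    using tendsto_minus[OF LIMSEQ_subseq_LIMSEQ[OF gl nj(1)]] by (simp add: o_def T_def)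
  have d0: "(\<lambda>j. d j - pi / (2 * \<nu> j)) \<longlonglongrightarrow> 0"
    unfolding d_def \<nu>_def by (rule Db_nphase_limit[OF x nj])
  \<comment> \<open>As pi > 3 and the phase has modulus at most 1, its cosecant term has modulus at
    least 3/2. A deviation below 1/2 leaves \<open>d j\<close> of modulus at least 1, so
    \<open>Db\<close> does not vanish and the quotient formula applies.\<close>
  have ev: "eventually (\<lambda>j. \<nu> j \<noteq> 0 \<and> \<bar>d j\<bar> \<ge> 1 \<and>
      real (nj j) * (berrut (nj j) f x - f x) = T j / d j) sequentially"
    using regular_eventually[OF nj] tendstoD[OF d0, of "1/2", simplified]
  proof eventually_elim
    case (elim j)
    then have n: "nj j \<noteq> 0" "\<forall>k\<le>nj j. x \<noteq> node k (nj j)" by auto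
    then have \<nu>: "\<nu> j \<noteq> 0" unfolding \<nu>_def by (intro nphase_nonzero x)
    have "\<bar>\<nu> j\<bar> \<le> 1" by (simp add: \<nu>_def abs_nphase_le_1)
    then have "\<bar>pi / (2 * \<nu> j)\<bar> \<ge> 3 / 2"
      using \<nu> pi_gt3 by (simp add: abs_mult divide_simps)
    moreover have "\<bar>d j - pi / (2 * \<nu> j)\<bar> < 1/2" using elim by (simp add: dist_real_def)
    ultimately have d: "\<bar>d j\<bar> \<ge> 1" by linarith
    then have "Db (nj j) x \<noteq> 0" by (auto simp: d_def)
    then show ?case using berrut_error_quotient[OF n(2) _ n(1) g] d \<nu> by (simp add: d_def T_def)
  qed
  have "(\<lambda>j. \<bar>T j - p\<bar> + \<bar>p\<bar> * \<bar>d j - pi / (2 * \<nu> j)\<bar>) \<longlonglongrightarrow> 0 + \<bar>p\<bar> * 0"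
    by (intro tendsto_intros tendsto_rabs_zero T0 d0)
  then have lim: "(\<lambda>j. \<bar>T j - p\<bar> + \<bar>p\<bar> * \<bar>d j - pi / (2 * \<nu> j)\<bar>) \<longlonglongrightarrow> 0" by simp
  have "(\<lambda>j. real (nj j) * (berrut (nj j) f x - f x) - p * (2 * \<nu> j / pi)) \<longlonglongrightarrow> 0"
  proof (rule Lim_null_comparison[OF _ lim])
    show "eventually (\<lambda>j. norm (real (nj j) * (berrut (nj j) f x - f x) - p * (2 * \<nu> j / pi)) \<le>
        \<bar>T j - p\<bar> + \<bar>p\<bar> * \<bar>d j - pi / (2 * \<nu> j)\<bar>) sequentially"
      using ev
    proof eventually_elim
      case (elim j)
      define E where "E = pi / (2 * \<nu> j)"
      have d: "\<bar>d j\<bar> \<ge> 1" "d j \<noteq> 0" using elim by auto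
      have "\<bar>\<nu> j\<bar> \<le> 1" by (simp add: \<nu>_def abs_nphase_le_1)
      then have E: "\<bar>E\<bar> \<ge> 1" "E \<noteq> 0"
        using elim pi_gt3 by (auto simp: E_def abs_mult divide_simps)
      have inv: "2 * \<nu> j / pi = 1 / E" using elim by (simp add: E_def)
      \<comment> \<open>Separates the error of the numerator from the error of the reciprocal
        denominator.\<close>
      have "T j / d j - p * (1 / E) = (T j - p) / d j + p * ((E - d j) / (d j * E))"
        using d E by (simp add: field_simps)
      also have "\<bar>\<dots>\<bar> \<le> \<bar>(T j - p) / d j\<bar> + \<bar>p * ((E - d j) / (d j * E))\<bar>" by (rule abs_triangle_ineq)
      also have "\<dots> \<le> \<bar>T j - p\<bar> + \<bar>p\<bar> * \<bar>d j - E\<bar>"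
      proof (intro add_mono)
        show "\<bar>(T j - p) / d j\<bar> \<le> \<bar>T j - p\<bar>"
          using divide_left_mono[OF d(1), of "\<bar>T j - p\<bar>"] d by (simp add: abs_divide)
        have "1 * 1 \<le> \<bar>d j\<bar> * \<bar>E\<bar>" using d E by (intro mult_mono) auto
        then have "\<bar>(E - d j) / (d j * E)\<bar> \<le> \<bar>d j - E\<bar>"
          using divide_left_mono[of 1 "\<bar>d j * E\<bar>" "\<bar>d j - E\<bar>"] d E
          by (simp add: abs_divide abs_mult abs_minus_commute)
        then show "\<bar>p * ((E - d j) / (d j * E))\<bar> \<le> \<bar>p\<bar> * \<bar>d j - E\<bar>"
          unfolding abs_mult[of p] by (rule mult_left_mono) simp
      qed
      finally have bound: "\<bar>T j / d j - p * (1 / E)\<bar> \<le> \<bar>T j - p\<bar> + \<bar>p\<bar> * \<bar>d j - E\<bar>" .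
      have "real (nj j) * (berrut (nj j) f x - f x) = T j / d j" using elim by blast
      then show ?case using bound unfolding inv E_def[symmetric] real_norm_def by (simp only:)
    qed
  qed
  then show ?thesis by (simp add: p_def \<nu>_def)
qed

lemma berrut_error_limit_of_Db:
  assumes f: "AC1 f" and x: "-1 < x" "x < 1" and nj: "strict_mono nj" "regular x nj"
    and par: "\<forall>j. even (nj j) = b"
    and D: "(\<lambda>j. Db (nj j) x / real (nj j)) \<longlonglongrightarrow> w" and w: "w \<noteq> 0"
  shows "(\<lambda>j. real (nj j) * (berrut (nj j) f x - f x)) \<longlonglongrightarrow> parity_fun b f x / w"
proof -
  have "(\<lambda>j. pi / (2 * nphase x (nj j))) \<longlonglongrightarrow> w"
    using tendsto_diff[OF D Db_nphase_limit[OF x nj]] by simp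
  \<comment> \<open>The inversion is exact for every \<open>j\<close>, including zero phases, since
    division by 0 gives 0.\<close>
  from tendsto_inverse[OF this w] have "(\<lambda>j. 2 * nphase x (nj j) / pi) \<longlonglongrightarrow> inverse w" by simp
  from tendsto_add[OF berrut_error_nphase_limit[OF f x nj par] tendsto_mult_left[OF this, of "parity_fun b f x"]]
  show ?thesis by (simp add: divide_inverse)
qed

section \<open>Rational points: finitely many phases\<close>

lemma finite_range_nphase:
  assumes "x \<in> \<rat>"
  shows "finite (range (nphase x))"
proof -
  have "(x + 1) / 2 \<in> \<rat>" using assms by simp
  then obtain a b where b: "b > 0" and ab: "(x + 1) / 2 = of_int a / of_int b" by (rule Rats_cases')
  define B where "B = nat b"
  have B: "B > 0" "(x + 1) / 2 = of_int a / real B" using b ab by (auto simp: B_def)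
  \<comment> \<open>If (x + 1)/2 = a/B, raising \<open>n\<close> by 2 B adds 2 pi a to the argument
    of the sine.\<close>
  have "nphase x n = nphase x (n mod (2 * B))" for n
  proof -
    have "real n = real (2 * B * (n div (2 * B)) + n mod (2 * B))" by simp
    then have n: "real n = 2 * real B * real (n div (2 * B)) + real (n mod (2 * B))"
      by (simp only: of_nat_add of_nat_mult of_nat_numeral)
    have ph: "nphase x m = sin (pi * (real m * (of_int a / real B)))" for m
      using B(2) by (simp add: nphase_def flip: B(2))
    have "pi * (real n * (of_int a / real B)) = 
       pi * (real (n mod (2 * B)) * (of_int a / real B)) + 2 * pi * of_int (int (n div (2 * B)) * a)"
      unfolding n using B(1) by (simp add: field_simps)
    then show ?thesis unfolding ph by (simp only: sin_add sin_int_2pin cos_int_2pin mult_1_right mult_zero_right add_0_right)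
  qed
  then have "range (nphase x) \<subseteq> nphase x ` {..<2 * B}" using B(1) by fastforce
  then show ?thesis by (rule finite_subset) simp
qed

text \<open>Along a regular sequence D_n(x)/n approaches values pi/(2 \<open>nphase\<close>) that
  eventually lie in a finite set of nonzero reals, so every limit, even in the extended reals,
  belongs to that set.\<close>

lemma parity_set_rational:
  assumes xr: "x \<in> \<rat>" and x: "-1 < x" "x < 1"
  shows "finite (parity_set b x) \<and> parity_set b x \<subseteq> ereal ` (UNIV - {0})"
proof -
  define F where "F = (\<lambda>\<nu>. pi / (2 * \<nu>)) ` (range (nphase x) - {0})"
  have F: "finite F" "0 \<notin> F" using finite_range_nphase[OF xr] by (auto simp: F_def)
  have "parity_set b x \<subseteq> ereal ` F"
  proof
    fix y assume "y \<in> parity_set b x"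
    then obtain nj where nj: "strict_mono nj" "regular x nj"
      and lim: "(\<lambda>j. ereal (Db (nj j) x / real (nj j))) \<longlonglongrightarrow> y"
      unfolding parity_set_def by blast
    define W where "W j = pi / (2 * nphase x (nj j))" for j
    obtain j0 where "\<forall>j\<ge>j0. nj j \<noteq> 0 \<and> (\<forall>k\<le>nj j. x \<noteq> node k (nj j))"
      using regular_eventually[OF nj] unfolding eventually_sequentially by blast
    \<comment> \<open>The shift by \<open>j0\<close> skips the indices where \<open>x\<close> may
      still be a node and the phase zero.\<close>
    then have "W (j + j0) \<in> F" for j
      unfolding F_def W_def using nphase_nonzero[OF x, of "nj (j + j0)"] by auto
    then obtain w r where w: "w \<in> F" and r: "strict_mono r" and Wr: "((\<lambda>j. W (j + j0)) \<circ> r) \<longlonglongrightarrow> w"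
      using finite_imp_compact[OF F(1)] unfolding compact_eq_seq_compact_metric seq_compact_def by metis
    define q where "q j = r j + j0" for j
    have q: "strict_mono q" using r by (simp add: q_def strict_mono_def)
    have "(\<lambda>j. Db (nj (q j)) x / real (nj (q j)) - W (q j)) \<longlonglongrightarrow> 0"
      using LIMSEQ_subseq_LIMSEQ[OF Db_nphase_limit[OF x nj] q] by (simp add: o_def W_def)
    moreover have "(\<lambda>j. W (q j)) \<longlonglongrightarrow> w" using Wr by (simp add: o_def q_def)
    ultimately have "(\<lambda>j. Db (nj (q j)) x / real (nj (q j))) \<longlonglongrightarrow> w"
      using tendsto_add by fastforce
    then have "(\<lambda>j. ereal (Db (nj (q j)) x / real (nj (q j)))) \<longlonglongrightarrow> ereal w" by simp
    moreover have "(\<lambda>j. ereal (Db (nj (q j)) x / real (nj (q j)))) \<longlonglongrightarrow> y"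
      using LIMSEQ_subseq_LIMSEQ[OF lim q] by (simp add: o_def)
    ultimately have "y = ereal w" by (rule LIMSEQ_unique[rotated])
    then show "y \<in> ereal ` F" using w by blast
  qed
  then show ?thesis using F finite_subset by blast
qed

section \<open>Irrational points: density of the phases\<close>

lemma irrational_regular:
  assumes "x \<notin> \<rat>"
  shows "regular x nj"
proof -
  have "node k n \<in> \<rat>" for k n unfolding node_def by simp
  then show ?thesis unfolding regular_def using assms by metis
qed

lemma abs_sin_diff_le:
  fixes u v :: real
  shows "\<bar>sin u - sin v\<bar> \<le> \<bar>u - v\<bar>"
proof -
  have "\<bar>sin u - sin v\<bar> = 2 * (\<bar>sin ((u - v) / 2)\<bar> * \<bar>cos ((u + v) / 2)\<bar>)"
    by (simp add: sin_diff_sin abs_mult)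
  also have "\<dots> \<le> 2 * (\<bar>(u - v) / 2\<bar> * 1)"
    by (intro mult_left_mono mult_mono abs_sin_x_le_abs_x abs_cos_le_one) auto
  finally show ?thesis by simp
qed

text \<open>Kronecker's theorem, applied to even steps so as to keep the parity: with n = 2(k + N) +
  \<rho>, the number n \<alpha> must come close to \<theta> modulo 2, where sin(pi \<theta>) =
  s.\<close>

lemma nphase_dense:
  assumes x: "x \<notin> \<rat>" and s: "\<bar>s\<bar> \<le> 1" and e: "e > 0"
  shows "\<exists>n>N. even n = b \<and> \<bar>nphase x n - s\<bar> < e"
proof -
  define \<alpha> where "\<alpha> = (x + 1) / 2"
  have \<alpha>: "\<alpha> \<notin> \<rat>"
  proof
    assume "\<alpha> \<in> \<rat>"
    then have "2 * \<alpha> - 1 \<in> \<rat>" by simp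
    moreover have "2 * \<alpha> - 1 = x" by (simp add: \<alpha>_def field_simps)
    ultimately show False using x by simp
  qed
  define \<rho> :: nat where "\<rho> = (if b then 0 else 1)"
  define \<theta> where "\<theta> = arcsin s / pi"
  have s\<theta>: "sin (pi * \<theta>) = s" using s by (simp add: \<theta>_def abs_le_iff)
  \<comment> \<open>The target is the condition on n \<alpha>, halved and solved for k \<alpha>
    modulo 1. The tolerance is multiplied by 2 pi on the way to the sine; the summand
    \<open>N\<close> makes \<open>n\<close> large.\<close>
  obtain h :: int and k :: int where k: "k > 0"
    and hk: "\<bar>of_int k * \<alpha> - of_int h - ((\<theta> - real \<rho> * \<alpha>) / 2 - real N * \<alpha>)\<bar> < e / (2 * pi)"
    by (rule sequence_of_fractional_parts_is_dense[OF \<alpha>,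
        of "e / (2 * pi)" "(\<theta> - real \<rho> * \<alpha>) / 2 - real N * \<alpha>"]) (use e in auto)
  define n where "n = 2 * (nat k + N) + \<rho>"
  have "n > N" "even n = b" using k by (auto simp: n_def \<rho>_def)
  moreover have "\<bar>nphase x n - s\<bar> < e"
  proof -
    define \<beta> where "\<beta> = of_int k * \<alpha> - of_int h - ((\<theta> - real \<rho> * \<alpha>) / 2 - real N * \<alpha>)"
    have "real n * \<alpha> = \<theta> + 2 * \<beta> + 2 * of_int h"
      using k by (simp add: n_def \<beta>_def field_simps)
    then have "pi * (real n * (x + 1) / 2) = pi * (\<theta> + 2 * \<beta>) + 2 * pi * of_int h"
      unfolding \<alpha>_def by (simp add: algebra_simps)
    then have "nphase x n = sin (pi * (\<theta> + 2 * \<beta>))"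
      unfolding nphase_def by (simp only: sin_add sin_int_2pin cos_int_2pin mult_1_right mult_zero_right add_0_right)
    then have "\<bar>nphase x n - s\<bar> = \<bar>sin (pi * (\<theta> + 2 * \<beta>)) - sin (pi * \<theta>)\<bar>" by (simp add: s\<theta>)
    also have "\<dots> \<le> \<bar>pi * (\<theta> + 2 * \<beta>) - pi * \<theta>\<bar>" by (rule abs_sin_diff_le)
    also have "\<dots> = 2 * pi * \<bar>\<beta>\<bar>" by (simp add: distrib_left abs_mult)
    also have "\<dots> < e" using hk[folded \<beta>_def] by (simp add: field_simps)
    finally show ?thesis .
  qed
  ultimately show ?thesis by blast
qed

lemma nphase_subsequence:
  assumes x: "x \<notin> \<rat>" and s: "\<bar>s\<bar> \<le> 1"
  obtains nj where "strict_mono nj" "\<forall>j. even (nj j) = b" "(\<lambda>j. nphase x (nj j)) \<longlonglongrightarrow> s"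
proof -
  have "\<forall>N j. \<exists>n>N. even n = b \<and> \<bar>nphase x n - s\<bar> < 1 / real (Suc j)"
    by (intro allI nphase_dense[OF x s]) simp
  then obtain c where c: "\<And>N j. c N j > N \<and> even (c N j) = b \<and> \<bar>nphase x (c N j) - s\<bar> < 1 / real (Suc j)"
    by metis
  \<comment> \<open>Each new index exceeds the previous one and meets the next tolerance.\<close>
  define nj where "nj = rec_nat (c 0 0) (\<lambda>j N. c N (Suc j))"
  have nj_Suc: "nj (Suc j) = c (nj j) (Suc j)" for j by (simp add: nj_def)
  have P: "even (nj j) = b \<and> \<bar>nphase x (nj j) - s\<bar> < 1 / real (Suc j)" for j
  proof (cases j)
    case 0
    then show ?thesis using c[of 0 0] by (simp add: nj_def)
  next
    case (Suc i)
    then show ?thesis using c[of "nj i" "Suc i"] by (simp add: nj_Suc)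
  qed
  have "strict_mono nj" using c by (simp add: strict_mono_Suc_iff nj_Suc)
  moreover have "(\<lambda>j. nphase x (nj j)) \<longlonglongrightarrow> s"
    unfolding LIM_zero_iff[symmetric, of _ s]
  proof (rule Lim_null_comparison)
    show "eventually (\<lambda>j. norm (nphase x (nj j) - s) \<le> 1 / real (Suc j)) sequentially"
      using P by (intro always_eventually) (simp add: less_imp_le)
    show "(\<lambda>j. 1 / real (Suc j)) \<longlonglongrightarrow> 0" using LIMSEQ_inverse_real_of_nat by (simp add: inverse_eq_divide)
  qed
  ultimately show thesis using that P by blast
qed

section \<open>Identification of the limit sets\<close>

lemma star_lim_imp_mem_parity_fset:
  assumes f: "AC1 f" and x: "x \<in> {-1..1}" and nj: "strict_mono nj" "regular x nj"
    and par: "\<forall>j. even (nj j) = b" and L: "star_lim f x nj L"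
  shows "L \<in> parity_fset b f x"
proof -
  note xi = regular_interior[OF x nj]
  define p where "p = parity_fun b f x"
  define X where "X j = real (nj j) * (berrut (nj j) f x - f x)" for j
  have XL: "(\<lambda>j. ereal (X j)) \<longlonglongrightarrow> L" using L by (simp add: star_lim_def X_def)
  \<comment> \<open>Since the whole sequence converges to \<open>L\<close>, the limit along any one
    subsequence determines it.\<close>
  have L_eq: "L = ereal l" if "strict_mono r" "(\<lambda>j. X (r j)) \<longlonglongrightarrow> l" for r l
  proof -
    have "(\<lambda>j. ereal (X (r j))) \<longlonglongrightarrow> ereal l" using that(2) by simp
    moreover have "(\<lambda>j. ereal (X (r j))) \<longlonglongrightarrow> L"
      using LIMSEQ_subseq_LIMSEQ[OF XL that(1)] by (simp add: o_def)
    ultimately show ?thesis by (rule LIMSEQ_unique[rotated])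
  qed
  show ?thesis
  proof (cases "x \<in> \<rat>")
    case True
    \<comment> \<open>Compactness of the extended reals makes D_n(x)/n converge along a subsequence,
      which itself witnesses that \<open>y\<close> belongs to the limit set; so \<open>y\<close> is
      real and nonzero.\<close>
    obtain y r where r: "strict_mono r"
      and y: "((\<lambda>j. ereal (Db (nj j) x / real (nj j))) \<circ> r) \<longlonglongrightarrow> y"
      using compact_complete_linorder[of "\<lambda>j. ereal (Db (nj j) x / real (nj j))"] by blast
    have njr: "strict_mono (nj \<circ> r)" "regular x (nj \<circ> r)" "\<forall>j. even ((nj \<circ> r) j) = b"
    proof -
      show "regular x (nj \<circ> r)"
        using nj(2) seq_suble[OF r] unfolding regular_def by (metis comp_apply order_trans)
    qed (use nj r par strict_mono_o in auto)
    then have ymem: "y \<in> parity_set b x" unfolding parity_set_def using y by (auto simp: o_def)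
    then obtain w where w: "y = ereal w" "w \<noteq> 0" using parity_set_rational[OF True xi, of b] by auto
    have "(\<lambda>j. Db ((nj \<circ> r) j) x / real ((nj \<circ> r) j)) \<longlonglongrightarrow> w" using y w by (simp add: o_def)
    from berrut_error_limit_of_Db[OF f xi njr this w(2)] have "(\<lambda>j. X (r j)) \<longlonglongrightarrow> p / w"
      by (simp add: X_def p_def)
    from L_eq[OF r this] show ?thesis using True ymem w(1) by (auto simp: parity_fset_def p_def)
  next
    case False
    \<comment> \<open>The error is asymptotic to \<open>Y\<close>, which stays in the compact
      interval of the claim.\<close>
    define Y where "Y j = p * (2 * nphase x (nj j) / pi)" for j
    have "\<bar>Y j\<bar> \<le> 2 * \<bar>p\<bar> / pi" for j
    proof -
      have "\<bar>p\<bar> * (2 * \<bar>nphase x (nj j)\<bar> / pi) \<le> \<bar>p\<bar> * (2 * 1 / pi)"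
        by (intro mult_left_mono divide_right_mono abs_nphase_le_1) auto
      then show ?thesis by (simp add: Y_def abs_mult mult.commute)
    qed
    then have "\<forall>j. Y j \<in> {- 2 * \<bar>p\<bar> / pi .. 2 * \<bar>p\<bar> / pi}" by (simp add: abs_le_iff minus_le_iff)
    then obtain l r where l: "l \<in> {- 2 * \<bar>p\<bar> / pi .. 2 * \<bar>p\<bar> / pi}" and r: "strict_mono r"
      and Yr: "(Y \<circ> r) \<longlonglongrightarrow> l"
      using compact_Icc[of "- 2 * \<bar>p\<bar> / pi" "2 * \<bar>p\<bar> / pi"]
      unfolding compact_eq_seq_compact_metric seq_compact_def by metis
    have "(\<lambda>j. X j - Y j) \<longlonglongrightarrow> 0"
      unfolding X_def Y_def p_def by (rule berrut_error_nphase_limit[OF f xi nj par])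
    from tendsto_add[OF LIMSEQ_subseq_LIMSEQ[OF this r] Yr] have "(\<lambda>j. X (r j)) \<longlonglongrightarrow> l"
      by (simp add: o_def)
    from L_eq[OF r this] show ?thesis using False l by (auto simp: parity_fset_def p_def)
  qed
qed

lemma mem_parity_fset_imp_star_lim:
  assumes f: "AC1 f" and x: "-1 < x" "x < 1" and L: "L \<in> parity_fset b f x"
  shows "\<exists>nj. strict_mono nj \<and> (\<forall>j. even (nj j) = b) \<and> regular x nj \<and> star_lim f x nj L"
proof (cases "x \<in> \<rat>")
  case True
  then obtain w where Lw: "L = ereal (parity_fun b f x / w)" and w: "ereal w \<in> parity_set b x"
    using L by (auto simp: parity_fset_def)
  then obtain nj where nj: "strict_mono nj" "regular x nj" "\<forall>j. even (nj j) = b"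
    and lim: "(\<lambda>j. Db (nj j) x / real (nj j)) \<longlonglongrightarrow> w"
    unfolding parity_set_def by auto
  have "w \<noteq> 0" using parity_set_rational[OF True x, of b] w by auto
  from berrut_error_limit_of_Db[OF f x nj lim this] show ?thesis
    using nj Lw by (auto simp: star_lim_def)
next
  case False
  define p where "p = parity_fun b f x"
  obtain l where Ll: "L = ereal l" and l: "\<bar>l\<bar> \<le> 2 * \<bar>p\<bar> / pi"
    using L False by (auto simp: parity_fset_def p_def abs_le_iff)
  \<comment> \<open>The phase that would produce the limit \<open>l\<close>. If \<open>p = 0\<close>
    then \<open>l = 0\<close>, and division by 0 gives \<open>s = 0\<close>, which still
    works.\<close>
  define s where "s = l * pi / (2 * p)"
  have s1: "\<bar>s\<bar> \<le> 1"
    using l by (cases "p = 0") (auto simp: s_def abs_mult abs_divide field_simps)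
  have ls: "p * (2 * s / pi) = l" using l by (cases "p = 0") (auto simp: s_def)
  obtain nj where nj: "strict_mono nj" "\<forall>j. even (nj j) = b" and lim: "(\<lambda>j. nphase x (nj j)) \<longlonglongrightarrow> s"
    by (rule nphase_subsequence[OF False s1])
  have reg: "regular x nj" by (rule irrational_regular[OF False])
  have "(\<lambda>j. p * (2 * nphase x (nj j) / pi)) \<longlonglongrightarrow> p * (2 * s / pi)"
    by (intro tendsto_intros lim) simp_all
  from tendsto_add[OF berrut_error_nphase_limit[OF f x nj(1) reg nj(2)] this[unfolded p_def]]
  have "(\<lambda>j. real (nj j) * (berrut (nj j) f x - f x)) \<longlonglongrightarrow> l" using ls by (simp add: p_def)
  then show ?thesis using nj reg Ll by (auto simp: star_lim_def)
qed

lemma parity_unfold: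
  "Oset = parity_set False" "Eset = parity_set True"
  "OfSet = parity_fset False" "EfSet = parity_fset True"
proof -
  show sets: "Oset = parity_set False" "Eset = parity_set True"
    by (rule ext, simp add: Oset_def Eset_def parity_set_def)+
  show "OfSet = parity_fset False" "EfSet = parity_fset True"
    by (intro ext, simp only: OfSet_def EfSet_def parity_fset_def parity_fun_def sets if_True if_False)+
qed

theorem theorem1:
  fixes f :: "real \<Rightarrow> real" and x :: real
  assumes hf: "AC1 f" and hx: "x \<in> {-1..1}"
  shows
    \<comment> \<open>(i) odd sequences\<close>
    "(\<forall>nj L. strict_mono nj \<and> (\<forall>j. odd (nj j)) \<and> star_lim f x nj L \<longrightarrow>
        (x \<notin> \<rat> \<longrightarrow> L \<in> OfSet f x) \<and>
        (x \<in> \<rat> \<and> regular x nj \<longrightarrow> L \<in> OfSet f x))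
     \<and> (x \<in> \<rat> \<and> -1 < x \<and> x < 1 \<longrightarrow>
          finite (Oset x) \<and> Oset x \<subseteq> ereal ` (UNIV - {0}))
     \<and> (\<forall>L. (x \<notin> \<rat> \<or> (-1 < x \<and> x < 1)) \<and> L \<in> OfSet f x \<longrightarrow>
          (\<exists>nj. strict_mono nj \<and> (\<forall>j. odd (nj j)) \<and> regular x nj \<and> star_lim f x nj L))
    \<comment> \<open>(ii) even sequences\<close>
     \<and> (\<forall>nj L. strict_mono nj \<and> (\<forall>j. even (nj j)) \<and> star_lim f x nj L \<longrightarrow>
        (x \<notin> \<rat> \<longrightarrow> L \<in> EfSet f x) \<and>
        (x \<in> \<rat> \<and> regular x nj \<longrightarrow> L \<in> EfSet f x))
     \<and> (x \<in> \<rat> \<and> -1 < x \<and> x < 1 \<longrightarrow>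
          finite (Eset x) \<and> Eset x \<subseteq> ereal ` (UNIV - {0}))
     \<and> (\<forall>L. (x \<notin> \<rat> \<or> (-1 < x \<and> x < 1)) \<and> L \<in> EfSet f x \<longrightarrow>
          (\<exists>nj. strict_mono nj \<and> (\<forall>j. even (nj j)) \<and> regular x nj \<and> star_lim f x nj L))"
proof -
  have interior: "-1 < x" "x < 1" if "x \<notin> \<rat> \<or> (-1 < x \<and> x < 1)"
  proof -
    have "x \<noteq> 1" "x \<noteq> -1" using that by auto
    then show "-1 < x" "x < 1" using hx by auto
  qed
  have fwd: "L \<in> parity_fset b f x"
    if "strict_mono nj" "\<forall>j. even (nj j) = b" "star_lim f x nj L" "x \<notin> \<rat> \<or> regular x nj" for nj b L
    using star_lim_imp_mem_parity_fset[OF hf hx that(1) _ that(2,3)] that(4) irrational_regular by blast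
  have bwd: "\<exists>nj. strict_mono nj \<and> (\<forall>j. even (nj j) = b) \<and> regular x nj \<and> star_lim f x nj L"
    if "x \<notin> \<rat> \<or> (-1 < x \<and> x < 1)" "L \<in> parity_fset b f x" for b L
    using mem_parity_fset_imp_star_lim[OF hf interior[OF that(1)] that(2)] .
  show ?thesis
    unfolding parity_unfold
    using fwd[of _ False] fwd[of _ True] bwd[of _ False] bwd[of _ True]
      parity_set_rational[of x False] parity_set_rational[of x True]
    by (intro conjI allI impI) auto
qed

end
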